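(* Let $E$ be an order continuous Banach lattice or a Köthe function space. The following are equivalent: (1) $E$ is upper locally uniformly monotone. (2) The complexification $E^{\mathbb{C}}$ is locally uniformly complex convex. (3) $E^{(p)}$ is midpoint locally uniformly convex for all $1<p<\infty$. (4) $E^{(p)}$ is midpoint locally uniformly convex for some $1<p<\infty$.
   Context: For a Banach lattice $E$ and $1<p<\infty$, the $p$-convexification $E^{(p)}$ is the vector lattice with the same underlying set and order as $E$ but with operations $x\oplus y=(x^{1/p}+y^{1/p})^p$ and $\alpha\odot x=\alpha^p x$ (powers taken as $\mathrm{sign}(t)|t|^s$ via the Krivine functional calculus), normed by $\|x\|_{E^{(p)}}=\|x\|_E^{1/p}$. For $1\le q<\infty$, $x\in S_E$, $\epsilon>0$ let $N_q(\epsilon;x)=\inf\{\|(|x|^q+|y|^q)^{1/q}\|-1:\|y\|\ge\epsilon\}$; $E$ is upper locally uniformly monotone if for some $1\le q<\infty$, $N_q(\epsilon;x)>0$ for all $x\in S_E$ and $\epsilon>0$. The complexification $E^{\mathbb{C}}=\{x+iy:x,y\in E\}$ has norm $\|x+iy\|=\|(|x|^2+|y|^2)^{1/2}\|_E$. In a complex Banach space $X$, a point $x\in S_X$ is a complex strongly extreme point if there is $0<q<\infty$ such that for every $\epsilon>0$, $\inf\{(\frac{1}{2\pi}\int_0^{2\pi}\|x+e^{i\theta}y\|^q\,d\theta)^{1/q}-1:\|y\|\ge\epsilon\}>0$; $X$ is locally uniformly complex convex if every point of $S_X$ is a complex strongly extreme point. A real Banach space $Y$ is midpoint locally uniformly convex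 if every $x\in S_Y$ is a strongly extreme point of $B_Y$, i.e. for every $\epsilon>0$ there is $\delta>0$ with $\inf\{\max\{\|x+y\|,\|x-y\|\}:\|y\|\ge\epsilon\}\ge1+\delta$. *)

theory Defs
  imports "HOL-Analysis.Analysis"
begin

class banach_lattice = banach + ordered_real_vector + lattice +
  assumes lattice_norm:
    "sup x (- x) \<le> sup y (- y) \<Longrightarrow> norm x \<le> norm y"

definition labs :: "'a::banach_lattice \<Rightarrow> 'a" where
  "labs x = sup x (- x)"

definition H2 :: "(real \<times> real \<Rightarrow> real) set" where
  "H2 = {f. continuous_on UNIV f \<and>
             (\<forall>t::real. \<forall>a b. t \<ge> 0 \<longrightarrow> f (t * a, t * b) = t * f (a, b))}"

definition krivine_hom :: "'a::banach_lattice \<Rightarrow> 'a \<Rightarrow> ((real \<times> real \<Rightarrow> real) \<Rightarrow> 'a) \<Rightarrow> bool" where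
  "krivine_hom x y T \<longleftrightarrow>
     (\<forall>g\<in>H2. \<forall>h\<in>H2. T (\<lambda>u. g u + h u) = T g + T h) \<and>
     (\<forall>g\<in>H2. \<forall>c::real. T (\<lambda>u. c * g u) = c *\<^sub>R T g) \<and>
     (\<forall>g\<in>H2. \<forall>h\<in>H2. T (\<lambda>u. max (g u) (h u)) = sup (T g) (T h)) \<and>
     T fst = x \<and> T snd = y"

definition krivine2 :: "'a::banach_lattice \<Rightarrow> 'a \<Rightarrow> (real \<times> real \<Rightarrow> real) \<Rightarrow> 'a" where
  "krivine2 x y f = (THE z. \<exists>T. krivine_hom x y T \<and> z = T f)"

definition spow :: "real \<Rightarrow> real \<Rightarrow> real" where
  "spow s t = sgn t * \<bar>t\<bar> powr s"

definition order_continuous :: "'a::banach_lattice itself \<Rightarrow> bool" where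
  "order_continuous _ \<longleftrightarrow>
     (\<forall>D::'a set. D \<noteq> {} \<and> (\<forall>a\<in>D. \<forall>b\<in>D. \<exists>c\<in>D. c \<le> a \<and> c \<le> b) \<and>
        (\<forall>d\<in>D. 0 \<le> d) \<and> (\<forall>z. (\<forall>d\<in>D. z \<le> d) \<longrightarrow> z \<le> 0)
        \<longrightarrow> (\<forall>\<epsilon>>0. \<exists>d\<in>D. norm d < \<epsilon>))"

text \<open>\<open>koethe_function_space M \<Phi>\<close>: \<Phi> identifies the Banach lattice with a Koethe
  function space over the sigma-finite measure space M: an order (hence lattice)
  isomorphism onto an order ideal of L^0(M) containing a weak unit (a.e. strictly
  positive function); the norm is the given Banach lattice norm.\<close>
definition koethe_function_space :: "'b measure \<Rightarrow> ('a::banach_lattice \<Rightarrow> 'b \<Rightarrow> real) \<Rightarrow> bool" where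
  "koethe_function_space M \<Phi> \<longleftrightarrow>
     sigma_finite_measure M \<and>
     (\<forall>x. \<Phi> x \<in> borel_measurable M) \<and>
     (\<forall>x y. AE \<omega> in M. \<Phi> (x + y) \<omega> = \<Phi> x \<omega> + \<Phi> y \<omega>) \<and>
     (\<forall>x c. AE \<omega> in M. \<Phi> (c *\<^sub>R x) \<omega> = c * \<Phi> x \<omega>) \<and>
     (\<forall>x y. x \<le> y \<longleftrightarrow> (AE \<omega> in M. \<Phi> x \<omega> \<le> \<Phi> y \<omega>)) \<and>
     (\<forall>f\<in>borel_measurable M. \<forall>x. (AE \<omega> in M. \<bar>f \<omega>\<bar> \<le> \<bar>\<Phi> x \<omega>\<bar>)
          \<longrightarrow> (\<exists>y. AE \<omega> in M. \<Phi> y \<omega> = f \<omega>)) \<and>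
     (\<exists>e. AE \<omega> in M. \<Phi> e \<omega> > 0)"

definition upper_LUM :: "'a::banach_lattice itself \<Rightarrow> bool" where
  "upper_LUM _ \<longleftrightarrow>
     (\<exists>q::real. 1 \<le> q \<and>
       (\<forall>x::'a. norm x = 1 \<longrightarrow> (\<forall>\<epsilon>>0. \<exists>\<delta>>0. \<forall>y::'a. norm y \<ge> \<epsilon> \<longrightarrow>
          norm (krivine2 x y (\<lambda>(s, t). (\<bar>s\<bar> powr q + \<bar>t\<bar> powr q) powr (1 / q))) - 1 \<ge> \<delta>)))"

text \<open>Elements x + iy of the complexification are represented as pairs (x, y).\<close>
definition cnorm :: "'a::banach_lattice \<times> 'a \<Rightarrow> real" where
  "cnorm z = norm (krivine2 (fst z) (snd z) (\<lambda>(s, t). sqrt (s\<^sup>2 + t\<^sup>2)))"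

definition cadd :: "'a::banach_lattice \<times> 'a \<Rightarrow> 'a \<times> 'a \<Rightarrow> 'a \<times> 'a" where
  "cadd z w = (fst z + fst w, snd z + snd w)"

definition crot :: "real \<Rightarrow> 'a::banach_lattice \<times> 'a \<Rightarrow> 'a \<times> 'a" where
  "crot \<theta> z = (cos \<theta> *\<^sub>R fst z - sin \<theta> *\<^sub>R snd z, sin \<theta> *\<^sub>R fst z + cos \<theta> *\<^sub>R snd z)"

definition complex_strongly_extreme :: "'a::banach_lattice \<times> 'a \<Rightarrow> bool" where
  "complex_strongly_extreme x \<longleftrightarrow>
     (\<exists>q::real. 0 < q \<and> (\<forall>\<epsilon>>0. \<exists>\<delta>>0. \<forall>y. cnorm y \<ge> \<epsilon> \<longrightarrow>
        ((1 / (2 * pi)) * integral {0..2 * pi} (\<lambda>\<theta>. cnorm (cadd x (crot \<theta> y)) powr q))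
          powr (1 / q) - 1 \<ge> \<delta>))"

definition complexification_LUCC :: "'a::banach_lattice itself \<Rightarrow> bool" where
  "complexification_LUCC _ \<longleftrightarrow>
     (\<forall>x::'a \<times> 'a. cnorm x = 1 \<longrightarrow> complex_strongly_extreme x)"

definition padd :: "real \<Rightarrow> 'a::banach_lattice \<Rightarrow> 'a \<Rightarrow> 'a" where
  "padd p x y = krivine2 x y (\<lambda>(s, t). spow p (spow (1 / p) s + spow (1 / p) t))"

definition pscale :: "real \<Rightarrow> real \<Rightarrow> 'a::banach_lattice \<Rightarrow> 'a" where
  "pscale p \<alpha> x = spow p \<alpha> *\<^sub>R x"

definition pnorm :: "real \<Rightarrow> 'a::banach_lattice \<Rightarrow> real" where
  "pnorm p x = norm x powr (1 / p)"

definition convexification_MLUC :: "'a::banach_lattice itself \<Rightarrow> real \<Rightarrow> bool" where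
  "convexification_MLUC _ p \<longleftrightarrow>
     (\<forall>x::'a. pnorm p x = 1 \<longrightarrow> (\<forall>\<epsilon>>0. \<exists>\<delta>>0. \<forall>y::'a. pnorm p y \<ge> \<epsilon> \<longrightarrow>
        max (pnorm p (padd p x y)) (pnorm p (padd p x (pscale p (-1) y))) \<ge> 1 + \<delta>))"

end

theory Submission
  imports Defs "HOL-Library.Lattice_Algebras"
begin

text \<open>
  Every real-valued lattice homomorphism \<open>\<phi>\<close> on the principal ideal \<open>I\<^sub>u\<close> of a Banach
  lattice commutes with the functional calculus, \<open>\<phi> (f(x, y)) = f (\<phi> x, \<phi> y)\<close>, and these
  homomorphisms detect the order. Inequalities between calculus expressions may therefore
  be checked on scalars.

  All four conditions turn out to be equivalent to the case \<open>q = 1\<close> of upper local uniform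
  monotonicity: \<open>\<parallel>|x| + |y|\<parallel> \<ge> 1 + \<delta>\<close> whenever \<open>\<parallel>y\<parallel> \<ge> \<epsilon>\<close>. The scalar input is that a
  continuous homogeneous \<open>h\<close> with \<open>h(s, t) \<ge> |s|\<close>, strictly for \<open>t \<noteq> 0\<close>, satisfies
  \<open>h(s, t) \<ge> |s| + c (|t| - \<eta> |s|)\<^sup>+\<close> for some \<open>c > 0\<close>, by compactness. With \<open>\<eta> = \<epsilon>/2\<close> the
  excess \<open>(|y| - \<eta> |x|)\<^sup>+\<close> still has norm at least \<open>\<epsilon>/2\<close>. For midpoint convexity \<open>h\<close> is
  the average of \<open>|x \<oplus> y|\<close> and \<open>|x \<ominus> y|\<close>; for complex convexity it is the average of
  \<open>|x + e\<^sup>i\<^sup>\<theta> y|\<close> over four angles that differ by multiples of \<open>\<pi>/2\<close>. Conversely one perturbs \<open>|x|\<close> by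
  the \<open>y'\<close> with \<open>|x| \<oplus> y' = |x| + |y|\<close>, respectively uses \<open>|x + e\<^sup>i\<^sup>\<theta> y| \<le> |x| + |y|\<close>.
\<close>

section \<open>Absolute values, monotonicity of the norm and closedness of the order\<close>

instance banach_lattice \<subseteq> lattice_ab_group_add ..

lemma scaleR_half_nonneg: "0 \<le> (x::'a::ordered_real_vector) + x \<Longrightarrow> 0 \<le> x"
proof -
  assume "0 \<le> x + x"
  hence "0 \<le> (1/2) *\<^sub>R (x + x)" by (intro scaleR_nonneg_nonneg) auto
  thus ?thesis by (simp add: scaleR_add_right flip: scaleR_add_left)
qed

lemma labs_nonneg [simp]: "0 \<le> labs (x::'a::banach_lattice)"
proof (rule scaleR_half_nonneg)
  have "x + (- x) \<le> labs x + labs x" unfolding labs_def by (intro add_mono) auto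
  thus "0 \<le> labs x + labs x" by simp
qed

lemma le_labs: "(x::'a::banach_lattice) \<le> labs x"
  and minus_le_labs: "- (x::'a::banach_lattice) \<le> labs x"
  by (simp_all add: labs_def)

lemma labs_le_iff: "labs (x::'a::banach_lattice) \<le> y \<longleftrightarrow> x \<le> y \<and> - x \<le> y"
  by (simp add: labs_def)

lemma labs_le_sum:
  fixes x y :: "'a::banach_lattice"
  shows "labs x \<le> labs x + labs y" "labs y \<le> labs x + labs y"
  by simp_all

lemma labs_of_nonneg: "0 \<le> x \<Longrightarrow> labs (x::'a::banach_lattice) = x"
  unfolding labs_def by (rule sup_absorb1) (metis neg_le_0_iff_le order_trans)

lemma labs_minus: "labs (- x) = labs (x::'a::banach_lattice)"
  by (simp add: labs_def sup_commute)

lemma norm_mono: "labs x \<le> labs y \<Longrightarrow> norm x \<le> norm (y::'a::banach_lattice)"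
  using lattice_norm by (simp add: labs_def)

lemma norm_labs [simp]: "norm (labs x) = norm (x::'a::banach_lattice)"
  by (intro antisym norm_mono) (simp_all add: labs_of_nonneg)

lemma norm_le_of_labs_le: "labs x \<le> y \<Longrightarrow> norm x \<le> norm (y::'a::banach_lattice)"
  by (metis labs_nonneg labs_of_nonneg norm_mono order_trans)

lemma norm_le_of_nonneg_le: "0 \<le> x \<Longrightarrow> x \<le> y \<Longrightarrow> norm x \<le> norm (y::'a::banach_lattice)"
  by (simp add: labs_of_nonneg norm_le_of_labs_le)

text \<open>The positive part of \<open>x\<close> is dominated by \<open>labs y\<close> for each
  such \<open>y\<close>, so its norm is below every \<open>e\<close> and it vanishes.\<close>

lemma le_0_if_norm_approx:
  fixes x :: "'a::banach_lattice"
  assumes "\<And>e. e > 0 \<Longrightarrow> \<exists>y. x \<le> y \<and> norm y < e"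
  shows "x \<le> 0"
proof -
  have "norm (sup x 0) \<le> e" if "e > 0" for e
  proof -
    obtain y where y: "x \<le> y" "norm y < e" using assms[OF \<open>e > 0\<close>] by blast
    have "sup x 0 \<le> labs y" using order_trans[OF y(1) le_labs] by simp
    hence "norm (sup x 0) \<le> norm (labs y)" by (intro norm_le_of_nonneg_le) auto
    thus ?thesis using y(2) by simp
  qed
  hence "norm (sup x 0) = 0" 
    using field_le_epsilon[of "norm (sup x 0)" 0] by simp
  thus ?thesis by (metis norm_eq_zero sup.cobounded1)
qed

text \<open>The Archimedean property. It lets order estimates with an arbitrarily small multiple of
  a fixed element be passed to the limit.\<close>

lemma le_0_if_le_scaleR:
  fixes x u :: "'a::banach_lattice"
  assumes "\<And>e. e > 0 \<Longrightarrow> x \<le> e *\<^sub>R u"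
  shows "x \<le> 0"
proof (rule le_0_if_norm_approx)
  fix e :: real assume "e > 0"
  \<comment> \<open>The \<open>+ 1\<close> keeps the quotient meaningful when \<open>u = 0\<close>
    and makes the norm estimate strict.\<close>
  hence "e / (norm u + 1) > 0" by (simp add: add_nonneg_pos)
  moreover have "norm ((e / (norm u + 1)) *\<^sub>R u) < e"
  proof -
    have "0 < norm u + 1" by (simp add: add_nonneg_pos)
    thus ?thesis using \<open>e > 0\<close> by (simp add: pos_divide_less_eq distrib_left)
  qed
  ultimately show "\<exists>y. x \<le> y \<and> norm y < e" using assms by blast
qed

lemma lattice_limit_le:
  fixes z :: "nat \<Rightarrow> 'a::banach_lattice"
  assumes "z \<longlonglongrightarrow> l" "\<And>n. n \<ge> N \<Longrightarrow> z n \<le> b"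
  shows "l \<le> b"
proof -
  have "l - b \<le> 0"
  proof (rule le_0_if_norm_approx)
    fix e :: real assume "e > 0"
    then obtain M where M: "\<And>n. n \<ge> M \<Longrightarrow> norm (z n - l) < e"
      using assms(1) LIMSEQ_D by blast
    have "l - b \<le> l - z (max M N)" using assms(2)[of "max M N"] by simp
    moreover have "norm (l - z (max M N)) < e" using M[of "max M N"] by (simp add: norm_minus_commute)
    ultimately show "\<exists>y. l - b \<le> y \<and> norm y < e" by blast
  qed
  thus ?thesis by simp
qed

section \<open>Principal ideals and real-valued lattice homomorphisms on them\<close>

definition principal_ideal :: "'a::banach_lattice \<Rightarrow> 'a set" where
  "principal_ideal u = {x. \<exists>c. labs x \<le> c *\<^sub>R u}"

definition lattice_hom_on :: "'a::banach_lattice set \<Rightarrow> ('a \<Rightarrow> real) \<Rightarrow> bool" where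
  "lattice_hom_on I \<phi> \<longleftrightarrow>
     (\<forall>x\<in>I. \<forall>y\<in>I. \<phi> (x + y) = \<phi> x + \<phi> y \<and> \<phi> (sup x y) = max (\<phi> x) (\<phi> y)) \<and>
     (\<forall>x\<in>I. \<forall>c. \<phi> (c *\<^sub>R x) = c * \<phi> x)"

lemma principal_ideal_iff: "x \<in> principal_ideal u \<longleftrightarrow> (\<exists>c. x \<le> c *\<^sub>R u \<and> - x \<le> c *\<^sub>R u)"
  by (simp add: principal_ideal_def labs_le_iff)

lemma principal_ideal_add:
  assumes "x \<in> principal_ideal u" "y \<in> principal_ideal u"
  shows "x + y \<in> principal_ideal u"
proof -
  obtain c d where "x \<le> c *\<^sub>R u" "- x \<le> c *\<^sub>R u" "y \<le> d *\<^sub>R u" "- y \<le> d *\<^sub>R u"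
    using assms by (auto simp: principal_ideal_iff)
  hence "x + y \<le> (c + d) *\<^sub>R u" "- x + - y \<le> (c + d) *\<^sub>R u"
    unfolding scaleR_add_left by (blast intro: add_mono)+
  thus ?thesis unfolding principal_ideal_iff by (metis minus_add_distrib)
qed

lemma principal_ideal_scaleR:
  assumes "x \<in> principal_ideal u"
  shows "k *\<^sub>R x \<in> principal_ideal u"
proof -
  obtain c where c: "x \<le> c *\<^sub>R u" "- x \<le> c *\<^sub>R u"
    using assms by (auto simp: principal_ideal_iff)
  have "\<bar>k\<bar> *\<^sub>R x \<le> \<bar>k\<bar> *\<^sub>R c *\<^sub>R u" "\<bar>k\<bar> *\<^sub>R (- x) \<le> \<bar>k\<bar> *\<^sub>R c *\<^sub>R u"
    by (rule scaleR_left_mono; use c in simp)+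
  thus ?thesis unfolding principal_ideal_iff
    by (cases "k \<ge> 0") (auto intro!: exI[of _ "\<bar>k\<bar> * c"])
qed

lemma principal_ideal_solid:
  assumes "labs x \<le> y" "y \<in> principal_ideal u"
  shows "x \<in> principal_ideal u"
proof -
  obtain c where "labs y \<le> c *\<^sub>R u" using assms by (auto simp: principal_ideal_def)
  hence "labs x \<le> c *\<^sub>R u" using assms(1) le_labs[of y] by (meson order_trans)
  thus ?thesis by (auto simp: principal_ideal_def)
qed

lemma principal_ideal_labs: "x \<in> principal_ideal u \<Longrightarrow> labs x \<in> principal_ideal u"
  by (simp add: principal_ideal_def labs_of_nonneg)

lemma principal_ideal_minus: "x \<in> principal_ideal u \<Longrightarrow> - x \<in> principal_ideal u"
  by (simp add: principal_ideal_def labs_minus)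

lemma principal_ideal_diff:
  "x \<in> principal_ideal u \<Longrightarrow> y \<in> principal_ideal u \<Longrightarrow> x - y \<in> principal_ideal u"
  using principal_ideal_add[of x u "- y"] principal_ideal_minus by auto

lemma principal_ideal_sup:
  assumes "x \<in> principal_ideal u" "y \<in> principal_ideal u"
  shows "sup x y \<in> principal_ideal u"
proof (rule principal_ideal_solid)
  show "labs (sup x y) \<le> labs x + labs y"
  proof -
    have "x \<le> labs x + labs y" "y \<le> labs x + labs y"
      using add_mono[OF le_labs[of x] labs_nonneg[of y]] add_mono[OF labs_nonneg[of x] le_labs[of y]]
      by simp_all
    moreover have "- sup x y \<le> - x" by simp
    hence "- sup x y \<le> labs x + labs y"
      using add_mono[OF minus_le_labs[of x] labs_nonneg[of y]] by (metis add.right_neutral order_trans)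
    ultimately show ?thesis by (simp add: labs_le_iff)
  qed
  show "labs x + labs y \<in> principal_ideal u"
    using assms by (intro principal_ideal_add principal_ideal_labs)
qed

lemma principal_ideal_0: "0 \<in> principal_ideal u"
  by (auto simp: principal_ideal_def labs_of_nonneg intro!: exI[of _ 0])

lemma principal_ideal_le: "labs x \<le> u \<Longrightarrow> x \<in> principal_ideal u"
  by (auto simp: principal_ideal_def intro!: exI[of _ 1])

lemmas principal_ideal_intros = principal_ideal_add principal_ideal_scaleR principal_ideal_labs
  principal_ideal_minus principal_ideal_diff principal_ideal_sup principal_ideal_0

subsection \<open>Lattice homomorphisms detect the order\<close>

text \<open>If \<open>I\<close> is represented as a space of continuous functions, these are the functionals
  \<open>x \<mapsto> max\<^sub>F x\<close> for closed sets \<open>F\<close>; the minimal ones belong to points.\<close>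

definition max_sublinear_on :: "'a::banach_lattice set \<Rightarrow> ('a \<Rightarrow> real) \<Rightarrow> bool" where
  "max_sublinear_on I m \<longleftrightarrow>
     (\<forall>x\<in>I. \<forall>y\<in>I. m (x + y) \<le> m x + m y \<and> m (sup x y) = max (m x) (m y)) \<and>
     (\<forall>x\<in>I. \<forall>c\<ge>0. m (c *\<^sub>R x) = c * m x) \<and> (\<forall>x. x \<notin> I \<longrightarrow> m x = 0)"

lemma max_sublinear_onD:
  assumes "max_sublinear_on I m" "x \<in> I"
  shows "y \<in> I \<Longrightarrow> m (x + y) \<le> m x + m y"
    and "y \<in> I \<Longrightarrow> m (sup x y) = max (m x) (m y)"
    and "0 \<le> c \<Longrightarrow> m (c *\<^sub>R x) = c * m x"
  using assms by (auto simp: max_sublinear_on_def)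

text \<open>Subadditivity at \<open>x + - x = 0\<close>. The bound keeps infima along chains finite
  and gives one half of the oddness of a minimal functional.\<close>

lemma max_sublinear_lower:
  assumes "max_sublinear_on (principal_ideal u) m" "x \<in> principal_ideal u"
  shows "- m (- x) \<le> m x"
proof -
  have "m (0 *\<^sub>R x) = 0" using max_sublinear_onD(3)[OF assms, of 0] by simp
  moreover have "m (x + - x) \<le> m x + m (- x)"
    by (rule max_sublinear_onD(1)[OF assms principal_ideal_minus[OF assms(2)]])
  ultimately show ?thesis by simp
qed

text \<open>The new functional corresponds to the subset of \<open>F\<close> on which \<open>a\<close> attains its maximum.\<close>

lemma max_sublinear_refine:
  fixes u a :: "'a::banach_lattice"
  defines "I \<equiv> principal_ideal u"
  assumes m: "max_sublinear_on I m" and a: "a \<in> I"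
  obtains m' where "max_sublinear_on I m'" "\<And>x. m' x \<le> m x" "m' (- a) \<le> - m a"
proof -
  \<comment> \<open>If \<open>m\<close> is the maximum over a closed set \<open>F\<close>, then for
    large \<open>t\<close> the term \<open>t * a\<close> dominates, and \<open>g x t\<close>
    decreases to the maximum of \<open>x\<close> over those points of \<open>F\<close> where
    \<open>a\<close> is largest. So the infimum in \<open>m'\<close> is a limit as \<open>t\<close>
    grows.\<close>
  define g where "g x t = m (x + t *\<^sub>R a) - t * m a" for x t
  define m' where "m' x = (if x \<in> I then (INF t\<in>{0..}. g x t) else 0)" for x
  note I = principal_ideal_intros[where u = u, folded I_def]
  have lower: "- m (- x) \<le> g x t" if "x \<in> I" "0 \<le> t" for x t
  proof -
    have "m (t *\<^sub>R a) = m ((x + t *\<^sub>R a) + - x)" by simp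
    also have "\<dots> \<le> m (x + t *\<^sub>R a) + m (- x)"
      using that a by (intro max_sublinear_onD[OF m] I)
    finally show ?thesis using max_sublinear_onD(3)[OF m a \<open>0 \<le> t\<close>] by (simp add: g_def)
  qed
  have bdd: "bdd_below (g x ` {0..})" if "x \<in> I" for x
    using lower[OF that] by (intro bdd_belowI) auto
  have le_g: "m' x \<le> g x t" if "x \<in> I" "0 \<le> t" for x t
    using that bdd by (auto simp: m'_def intro!: cINF_lower)
  have ge: "b \<le> m' x" if "x \<in> I" "\<And>t. 0 \<le> t \<Longrightarrow> b \<le> g x t" for x b
    using that by (auto simp: m'_def intro!: cINF_greatest)
  have approx: "\<exists>t\<ge>0. g x t < b" if "x \<in> I" "m' x < b" for x b
  proof (rule ccontr)
    assume "\<not> ?thesis"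
    hence "b \<le> m' x" using that by (intro ge) (auto simp: not_less)
    thus False using that by simp
  qed
  have anti: "g x t \<le> g x s" if "x \<in> I" "0 \<le> s" "s \<le> t" for x s t
  proof -
    have "m (x + t *\<^sub>R a) = m ((x + s *\<^sub>R a) + (t - s) *\<^sub>R a)" by (simp add: algebra_simps)
    also have "\<dots> \<le> m (x + s *\<^sub>R a) + m ((t - s) *\<^sub>R a)"
      using that a by (intro max_sublinear_onD[OF m] I)
    also have "m ((t - s) *\<^sub>R a) = (t - s) * m a" using max_sublinear_onD(3)[OF m a] that by simp
    finally show ?thesis by (simp add: g_def algebra_simps)
  qed
  have g_sup: "g (sup x y) t = max (g x t) (g y t)" if "x \<in> I" "y \<in> I" for x y t
  proof -
    have "m (sup (x + t *\<^sub>R a) (y + t *\<^sub>R a)) = max (m (x + t *\<^sub>R a)) (m (y + t *\<^sub>R a))"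
      using that a by (intro max_sublinear_onD[OF m] I)
    thus ?thesis by (simp add: g_def add_sup_distrib_right max_def)
  qed
  have "m' (x + y) \<le> m' x + m' y" if xy: "x \<in> I" "y \<in> I" for x y
  proof (rule field_le_epsilon)
    fix e :: real assume "e > 0"
    then obtain s t where st: "s \<ge> 0" "g x s < m' x + e/2" "t \<ge> 0" "g y t < m' y + e/2"
      using approx[of x "m' x + e/2"] approx[of y "m' y + e/2"] xy by auto
    have "m (x + y + (s + t) *\<^sub>R a) = m ((x + s *\<^sub>R a) + (y + t *\<^sub>R a))" by (simp add: algebra_simps)
    also have "\<dots> \<le> m (x + s *\<^sub>R a) + m (y + t *\<^sub>R a)"
      using xy a by (intro max_sublinear_onD[OF m] I)
    finally have "g (x + y) (s + t) \<le> g x s + g y t" by (simp add: g_def algebra_simps)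
    moreover have "m' (x + y) \<le> g (x + y) (s + t)" using st xy by (intro le_g I) auto
    ultimately show "m' (x + y) \<le> m' x + m' y + e" using st by simp
  qed
  moreover have "m' (sup x y) = max (m' x) (m' y)" if xy: "x \<in> I" "y \<in> I" for x y
  proof (rule antisym)
    have "m' x \<le> m' (sup x y)" "m' y \<le> m' (sup x y)"
      using xy le_g by (auto intro!: ge I simp: g_sup max.coboundedI1 max.coboundedI2)
    thus "max (m' x) (m' y) \<le> m' (sup x y)" by simp
    show "m' (sup x y) \<le> max (m' x) (m' y)"
    proof (rule field_le_epsilon)
      fix e :: real assume "e > 0"
      then obtain s t where st: "s \<ge> 0" "g x s < m' x + e" "t \<ge> 0" "g y t < m' y + e"
        using approx[of x "m' x + e"] approx[of y "m' y + e"] xy by auto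
      \<comment> \<open>As \<open>g\<close> decreases in \<open>t\<close>, the larger of the two
        parameters serves \<open>x\<close> and \<open>y\<close> at once.\<close>
      have "m' (sup x y) \<le> max (g x (max s t)) (g y (max s t))"
        using le_g[of "sup x y" "max s t"] st xy by (auto simp: g_sup I)
      moreover have "g x (max s t) \<le> g x s" "g y (max s t) \<le> g y t" using st xy by (auto intro: anti)
      ultimately show "m' (sup x y) \<le> max (m' x) (m' y) + e" using st by auto
    qed
  qed
  moreover have "m' (c *\<^sub>R x) = c * m' x" if x: "x \<in> I" and c: "c \<ge> 0" for x c
  proof (cases "c = 0")
    case True
    have "g 0 t = 0" if "t \<ge> 0" for t using max_sublinear_onD(3)[OF m a that] by (simp add: g_def)
    hence "m' 0 = 0" using I(7) le_g[of 0 0] ge[of 0 0] by force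
    thus ?thesis using True by simp
  next
    case False
    with c have c: "c > 0" by simp
    \<comment> \<open>Stretching the parameter by \<open>c\<close> maps the nonnegative reals onto
      themselves, so both infima range over corresponding values.\<close>
    have g_scale: "g (c *\<^sub>R x) (c * t) = c * g x t" for t
    proof -
      have "m (c *\<^sub>R (x + t *\<^sub>R a)) = c * m (x + t *\<^sub>R a)"
        using x a c by (intro max_sublinear_onD[OF m] I) auto
      thus ?thesis by (simp add: g_def algebra_simps)
    qed
    show ?thesis
    proof (rule antisym)
      have "m' (c *\<^sub>R x) / c \<le> m' x"
      proof (rule ge[OF x])
        fix t :: real assume "0 \<le> t"
        hence "m' (c *\<^sub>R x) \<le> g (c *\<^sub>R x) (c * t)" using x c by (intro le_g I) auto
        thus "m' (c *\<^sub>R x) / c \<le> g x t" using c by (simp add: g_scale field_simps)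
      qed
      thus "m' (c *\<^sub>R x) \<le> c * m' x" using c by (simp add: field_simps)
      show "c * m' x \<le> m' (c *\<^sub>R x)"
      proof (rule ge)
        fix t :: real assume "0 \<le> t"
        hence "m' x \<le> g x (t / c)" using x c by (intro le_g) auto
        thus "c * m' x \<le> g (c *\<^sub>R x) t" using c g_scale[of "t / c"] by (simp add: field_simps)
      qed (use x in \<open>intro I\<close>)
    qed
  qed
  ultimately have "max_sublinear_on I m'" by (auto simp: max_sublinear_on_def m'_def)
  moreover have "m' x \<le> m x" for x
    using le_g[of x 0] m by (cases "x \<in> I") (auto simp: g_def m'_def max_sublinear_on_def)
  moreover have "m' (- a) \<le> - m a"
  proof -
    \<comment> \<open>At \<open>t = 1\<close> the argument \<open>- a + a\<close> vanishes and only
      \<open>- m a\<close> is left.\<close>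
    have "m' (- a) \<le> g (- a) 1" using a by (intro le_g I) auto
    also have "\<dots> = - m a" using max_sublinear_onD(3)[OF m a, of 0] by (simp add: g_def)
    finally show ?thesis .
  qed
  ultimately show ?thesis using that by blast
qed

text \<open>Near-optimal members at two points can be replaced by the smaller one, since the family
  is a chain; hence the pointwise infimum inherits all the properties. In terms of closed sets this
  is the intersection of a decreasing family. It supplies the lower bounds for Zorn's lemma.\<close>

lemma max_sublinear_chain_Inf:
  fixes u :: "'a::banach_lattice"
  defines "I \<equiv> principal_ideal u"
  assumes C: "C \<noteq> {}" "\<And>m. m \<in> C \<Longrightarrow> max_sublinear_on I m" "\<And>m x. m \<in> C \<Longrightarrow> m x \<le> m1 x"
    and chain: "\<And>m n. m \<in> C \<Longrightarrow> n \<in> C \<Longrightarrow> m \<le> n \<or> n \<le> m"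
  obtains m' where "max_sublinear_on I m'" "\<And>m x. m \<in> C \<Longrightarrow> m' x \<le> m x"
proof -
  define m' where "m' x = (INF m\<in>C. m x)" for x
  note I = principal_ideal_intros[where u = u, folded I_def]
  \<comment> \<open>On the ideal, \<open>m x \<ge> - m (- x) \<ge> - m1 (- x)\<close>; the
    \<open>0\<close> in the minimum covers points off the ideal, where \<open>m\<close> has the
    default value 0.\<close>
  have bdd: "bdd_below ((\<lambda>m. m x) ` C)" for x
  proof (rule bdd_belowI2[of _ "min 0 (- m1 (- x))"])
    fix m assume m: "m \<in> C"
    show "min 0 (- m1 (- x)) \<le> m x"
    proof (cases "x \<in> I")
      case True
      thus ?thesis using max_sublinear_lower[of u m x] C(2,3)[OF m] unfolding I_def
        by (meson le_minus_iff min.coboundedI2 neg_le_iff_le order_trans)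
    qed (use C(2)[OF m] in \<open>auto simp: max_sublinear_on_def\<close>)
  qed
  have le: "m' x \<le> m x" if "m \<in> C" for m x
    using that bdd by (auto simp: m'_def intro!: cINF_lower)
  have ge: "b \<le> m' x" if "\<And>m. m \<in> C \<Longrightarrow> b \<le> m x" for x b
    using that C(1) by (auto simp: m'_def intro!: cINF_greatest)
  have approx: "\<exists>m\<in>C. m x < b" if "m' x < b" for x b
    using that ge[of b x] by (meson leD not_less)
  have approx2: "\<exists>m\<in>C. m x < b \<and> m y < c" if bc: "m' x < b" "m' y < c" for x y b c
  proof -
    obtain m n where mn: "m \<in> C" "n \<in> C" "m x < b" "n y < c" using approx bc by meson
    thus ?thesis using chain[OF mn(1,2)] by (auto simp: le_fun_def intro: le_less_trans)
  qed
  have "m' (x + y) \<le> m' x + m' y" if xy: "x \<in> I" "y \<in> I" for x y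
  proof (rule field_le_epsilon)
    fix e :: real assume "e > 0"
    then obtain m where m: "m \<in> C" "m x < m' x + e/2" "m y < m' y + e/2"
      using approx2[of x "m' x + e/2" y "m' y + e/2"] by auto
    thus "m' (x + y) \<le> m' x + m' y + e"
      using le[OF m(1), of "x + y"] max_sublinear_onD(1)[OF C(2)[OF m(1)] xy] by simp
  qed
  moreover have "m' (sup x y) = max (m' x) (m' y)" if xy: "x \<in> I" "y \<in> I" for x y
  proof (rule antisym)
    show "max (m' x) (m' y) \<le> m' (sup x y)"
      by (rule ge) (simp add: max_sublinear_onD(2)[OF C(2) xy] le max.coboundedI1 max.coboundedI2)
    show "m' (sup x y) \<le> max (m' x) (m' y)"
    proof (rule field_le_epsilon)
      fix e :: real assume "e > 0"
      then obtain m where m: "m \<in> C" "m x < m' x + e" "m y < m' y + e"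
        using approx2[of x "m' x + e" y "m' y + e"] by auto
      thus "m' (sup x y) \<le> max (m' x) (m' y) + e"
        using le[OF m(1), of "sup x y"] max_sublinear_onD(2)[OF C(2)[OF m(1)] xy] by auto
    qed
  qed
  moreover have "m' (c *\<^sub>R x) = c * m' x" if x: "x \<in> I" and c: "c \<ge> 0" for x c
  proof (cases "c = 0")
    case True
    have "m (0::'a) = 0" if "m \<in> C" for m
      using max_sublinear_onD(3)[OF C(2)[OF that] x, of 0] by simp
    hence "m' 0 = (INF m\<in>C. 0)" unfolding m'_def by (intro INF_cong) auto
    thus ?thesis using True C(1) by simp
  next
    case False
    with c have c: "c > 0" by simp
    have *: "m (c *\<^sub>R x) = c * m x" if "m \<in> C" for m
      using max_sublinear_onD(3)[OF C(2)[OF that] x] c by simp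
    show ?thesis
    proof (rule antisym)
      have "m' (c *\<^sub>R x) / c \<le> m' x"
        using le[of _ "c *\<^sub>R x"] c * by (intro ge) (auto simp: field_simps)
      thus "m' (c *\<^sub>R x) \<le> c * m' x" using c by (simp add: field_simps)
      show "c * m' x \<le> m' (c *\<^sub>R x)" using c by (intro ge) (auto simp: * intro!: le)
    qed
  qed
  moreover have "m' x = 0" if "x \<notin> I" for x
  proof -
    have "m x = 0" if "m \<in> C" for m using C(2)[OF that] \<open>x \<notin> I\<close> by (auto simp: max_sublinear_on_def)
    hence "m' x = (INF m\<in>C. 0)" unfolding m'_def by (intro INF_cong) auto
    thus ?thesis using C(1) by simp
  qed
  ultimately have "max_sublinear_on I m'" by (auto simp: max_sublinear_on_def)
  thus ?thesis using that le by blast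
qed

text \<open>Zorn's lemma gives a minimal functional below \<open>m1\<close>. Refining it at any
  \<open>a\<close> cannot lower it, which forces \<open>m (- a) = - m a\<close>, and an odd
  sublinear functional is linear.\<close>

lemma max_sublinear_dominates_lattice_hom:
  fixes u :: "'a::banach_lattice"
  defines "I \<equiv> principal_ideal u"
  assumes m1: "max_sublinear_on I m1"
  obtains m where "lattice_hom_on I m" "\<And>x. m x \<le> m1 x"
proof -
  \<comment> \<open>All members vanish off the ideal, so minimality among functions on the whole
    space is minimality on the ideal.\<close>
  define A where "A = {m. max_sublinear_on I m \<and> m \<le> m1}"
  note I = principal_ideal_intros[where u = u, folded I_def]
  have "\<exists>m\<in>A. \<forall>n\<in>A. n \<le> m \<longrightarrow> n = m"
  proof (rule predicate_Zorn)
    show "partial_order_on A (relation_of (\<lambda>x y. y \<le> x) A)"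
      by (rule partial_order_on_relation_ofI) auto
    fix C assume C: "C \<in> Chains (relation_of (\<lambda>x y. y \<le> x) A)"
    show "\<exists>u\<in>A. \<forall>a\<in>C. u \<le> a"
    proof (cases "C = {}")
      case True
      thus ?thesis using m1 by (auto simp: A_def)
    next
      case False
      have sub: "C \<subseteq> A" using C by (auto simp: Chains_def relation_of_def)
      obtain m' where m': "max_sublinear_on I m'" "\<And>m x. m \<in> C \<Longrightarrow> m' x \<le> m x"
      proof (rule max_sublinear_chain_Inf[of C u m1, folded I_def])
        show "m \<le> n \<or> n \<le> m" if "m \<in> C" "n \<in> C" for m n
          using C that by (auto simp: Chains_def relation_of_def)
      qed (use False sub in \<open>auto simp: A_def le_fun_def\<close>)
      moreover have "m' \<in> A"
      proof -
        obtain m where "m \<in> C" using False by blast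
        hence "m' \<le> m" "m \<le> m1" using m'(2) sub by (auto simp: A_def le_fun_def)
        thus ?thesis using m'(1) by (auto simp: A_def)
      qed
      ultimately show ?thesis by (auto simp: le_fun_def)
    qed
  qed
  then obtain m where m: "max_sublinear_on I m" "m \<le> m1" and min: "\<And>n. n \<in> A \<Longrightarrow> n \<le> m \<Longrightarrow> n = m"
    by (auto simp: A_def)
  have neg: "m (- a) = - m a" if a: "a \<in> I" for a
  proof (rule antisym)
    obtain m' where m': "max_sublinear_on I m'" "\<And>x. m' x \<le> m x" "m' (- a) \<le> - m a"
      using max_sublinear_refine[of u m a, folded I_def, OF m(1) a] by blast
    hence "m' \<le> m" by (simp add: le_fun_def)
    hence "m' = m" using m m'(1) by (intro min) (auto simp: A_def)
    thus "m (- a) \<le> - m a" using m' by simp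
    show "- m a \<le> m (- a)" using max_sublinear_lower[of u m "-a", folded I_def, OF m(1)] a
      by (simp add: I)
  qed
  have "lattice_hom_on I m" unfolding lattice_hom_on_def
  proof (intro conjI ballI allI)
    fix x y assume xy: "x \<in> I" "y \<in> I"
    show "m (sup x y) = max (m x) (m y)" using max_sublinear_onD(2)[OF m(1) xy] .
    \<comment> \<open>Subadditivity at the negated arguments, read through oddness, is
      superadditivity.\<close>
    have "m (- x + - y) \<le> m (- x) + m (- y)" using xy by (intro max_sublinear_onD[OF m(1)] I)
    moreover have "- x + - y = - (x + y)" by simp
    ultimately have "- m (x + y) \<le> - m x - m y" using neg[of "x + y"] neg[of x] neg[of y] xy I(1) by simp
    thus "m (x + y) = m x + m y" using max_sublinear_onD(1)[OF m(1) xy] by simp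
  next
    fix x c assume x: "x \<in> I"
    show "m (c *\<^sub>R x) = c * m x"
    proof (cases "c \<ge> 0")
      case False
      hence "m ((- c) *\<^sub>R x) = (- c) * m x" by (intro max_sublinear_onD[OF m(1) x]) auto
      thus ?thesis using neg[of "c *\<^sub>R x"] I(2)[OF x] by simp
    qed (use max_sublinear_onD(3)[OF m(1) x] in auto)
  qed
  thus ?thesis using that m(2) by (auto simp: le_fun_def)
qed

text \<open>Start from the gauge \<open>m x\<close>, the least \<open>c\<close> with
  \<open>x \<le> c * u\<close>, which plays the role of the maximum over the whole spectrum. If
  \<open>w \<le> 0\<close> fails then \<open>m w > 0\<close>; refining at \<open>w\<close> and then
  passing to a homomorphism below yields \<open>\<phi> w \<ge> m w > 0\<close>.\<close>

lemma lattice_hom_separation: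
  fixes u w :: "'a::banach_lattice"
  assumes u: "0 \<le> u" and w: "w \<in> principal_ideal u"
    and hom: "\<And>\<phi>. lattice_hom_on (principal_ideal u) \<phi> \<Longrightarrow> \<phi> w \<le> 0"
  shows "w \<le> 0"
proof (rule ccontr)
  assume w0: "\<not> w \<le> 0"
  define I where "I = principal_ideal u"
  note I = principal_ideal_intros[where u = u, folded I_def]
  have "u \<noteq> 0" using w w0 by (auto simp: principal_ideal_iff)
  have pos: "0 \<le> c" if "0 \<le> c *\<^sub>R u" for c
  proof (rule ccontr)
    assume "\<not> 0 \<le> c"
    hence "0 \<le> - 1 / c" "c \<noteq> 0" by (auto simp: field_simps)
    hence "u \<le> 0" using scaleR_nonneg_nonneg[OF _ that, of "- 1 / c"] by simp
    thus False using u \<open>u \<noteq> 0\<close> by simp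
  qed
  \<comment> \<open>The infimum of the admissible \<open>c\<close> is itself admissible by the
    Archimedean property. The equivalence for all \<open>c\<close> determines the gauge, and its
    behaviour under suprema and scaling is read off from it.\<close>
  have ex: "\<exists>b. \<forall>c. x \<le> c *\<^sub>R u \<longleftrightarrow> b \<le> c" if "x \<in> I" for x
  proof -
    obtain k where k: "x \<le> k *\<^sub>R u" "- x \<le> k *\<^sub>R u" using \<open>x \<in> I\<close> by (auto simp: principal_ideal_iff I_def)
    define S where "S = {c. x \<le> c *\<^sub>R u}"
    have S: "S \<noteq> {}" "bdd_below S"
    proof -
      show "bdd_below S"
      proof (rule bdd_belowI[of _ "-k"])
        fix c assume "c \<in> S"
        hence "x + - x \<le> c *\<^sub>R u + k *\<^sub>R u" unfolding S_def using k by (intro add_mono) auto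
        thus "-k \<le> c" using pos[of "c + k"] by (simp add: scaleR_add_left)
      qed
    qed (use k in \<open>auto simp: S_def\<close>)
    have "x - Inf S *\<^sub>R u \<le> 0"
    proof (rule le_0_if_le_scaleR)
      fix e :: real assume "e > 0"
      then obtain c where "c \<in> S" "c < Inf S + e" using cInf_lessD[OF S(1), of "Inf S + e"] by auto
      hence "x \<le> c *\<^sub>R u" "c *\<^sub>R u \<le> (Inf S + e) *\<^sub>R u"
        using u by (auto simp: S_def intro: scaleR_right_mono)
      hence "x \<le> (Inf S + e) *\<^sub>R u" by simp
      thus "x - Inf S *\<^sub>R u \<le> e *\<^sub>R u" by (simp add: scaleR_add_left algebra_simps)
    qed
    hence "x \<le> Inf S *\<^sub>R u" by simp
    hence "x \<le> c *\<^sub>R u \<longleftrightarrow> Inf S \<le> c" for c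
      using u S scaleR_right_mono[of "Inf S" c u] cInf_lower[of c S] by (auto simp: S_def)
    thus ?thesis by blast
  qed
  then obtain b where b: "\<And>x c. x \<in> I \<Longrightarrow> x \<le> c *\<^sub>R u \<longleftrightarrow> b x \<le> c" by metis
  define m where "m x = (if x \<in> I then b x else 0)" for x
  have m: "x \<le> c *\<^sub>R u \<longleftrightarrow> m x \<le> c" if "x \<in> I" for x c using b that by (simp add: m_def)
  have "max_sublinear_on I m" unfolding max_sublinear_on_def
  proof (intro conjI ballI allI impI)
    fix x y assume xy: "x \<in> I" "y \<in> I"
    have "x + y \<le> (m x + m y) *\<^sub>R u"
      using m[of x "m x"] m[of y "m y"] xy by (simp add: scaleR_add_left add_mono)
    thus "m (x + y) \<le> m x + m y" using m[of "x + y"] xy I(1) by simp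
    have "m (sup x y) \<le> c \<longleftrightarrow> max (m x) (m y) \<le> c" for c
      using m[of "sup x y" c] m[of x c] m[of y c] xy I(6) by simp
    thus "m (sup x y) = max (m x) (m y)" by (meson antisym order_refl)
  next
    fix x and c :: real assume x: "x \<in> I" and c: "0 \<le> c"
    have zero: "m 0 = 0"
    proof (rule antisym)
      show "m 0 \<le> 0" using m[of 0 0] I(7) by simp
      show "0 \<le> m 0" using m[of 0 "m 0"] I(7) pos by simp
    qed
    show "m (c *\<^sub>R x) = c * m x"
    proof (cases "c = 0")
      case False
      with c have c: "c > 0" by simp
      have "m (c *\<^sub>R x) \<le> d \<longleftrightarrow> c * m x \<le> d" for d
      proof -
        have "c *\<^sub>R x \<le> d *\<^sub>R u \<longleftrightarrow> x \<le> (d / c) *\<^sub>R u"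
        proof
          assume "c *\<^sub>R x \<le> d *\<^sub>R u"
          from scaleR_left_mono[OF this, of "1/c"] c show "x \<le> (d / c) *\<^sub>R u" by simp
        next
          assume "x \<le> (d / c) *\<^sub>R u"
          from scaleR_left_mono[OF this, of c] c show "c *\<^sub>R x \<le> d *\<^sub>R u" by simp
        qed
        thus ?thesis using m[OF x] m[OF I(2)[OF x]] c by (simp add: field_simps)
      qed
      thus ?thesis by (meson antisym order_refl)
    qed (simp add: zero)
  qed (simp add: m_def)
  \<comment> \<open>After refinement at \<open>w\<close>, every homomorphism below \<open>m'\<close>
    satisfies \<open>- \<phi> w \<le> - m w\<close>.\<close>
  then obtain m' where m': "max_sublinear_on I m'" "m' (- w) \<le> - m w"
    using max_sublinear_refine[of u m w, folded I_def] w by (auto simp: I_def)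
  then obtain \<phi> where \<phi>: "lattice_hom_on I \<phi>" "\<phi> (- w) \<le> m' (- w)"
    using max_sublinear_dominates_lattice_hom[of u m', folded I_def] by blast
  have "\<phi> ((-1) *\<^sub>R w) = (-1) * \<phi> w" using \<phi>(1) w unfolding lattice_hom_on_def I_def by blast
  hence "m w \<le> \<phi> w" using \<phi>(2) m'(2) by simp
  also have "\<phi> w \<le> 0" by (rule hom[OF \<phi>(1)[unfolded I_def]])
  finally show False using m[of w 0] w w0 by (simp add: I_def)
qed

lemma lattice_hom_onD:
  assumes \<phi>: "lattice_hom_on (principal_ideal u) \<phi>" and x: "x \<in> principal_ideal u"
  shows "y \<in> principal_ideal u \<Longrightarrow> \<phi> (x + y) = \<phi> x + \<phi> y"
    and "y \<in> principal_ideal u \<Longrightarrow> \<phi> (sup x y) = max (\<phi> x) (\<phi> y)"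
    and "\<phi> (c *\<^sub>R x) = c * \<phi> x"
    and "\<phi> (- x) = - \<phi> x"
    and "y \<in> principal_ideal u \<Longrightarrow> \<phi> (x - y) = \<phi> x - \<phi> y"
    and "\<phi> (labs x) = \<bar>\<phi> x\<bar>"
proof -
  show add: "\<phi> (x + y) = \<phi> x + \<phi> y" if "y \<in> principal_ideal u" for y
    using assms that by (auto simp: lattice_hom_on_def)
  show sup: "\<phi> (sup x y) = max (\<phi> x) (\<phi> y)" if "y \<in> principal_ideal u" for y
    using assms that by (auto simp: lattice_hom_on_def)
  have scale: "\<phi> (c *\<^sub>R y) = c * \<phi> y" if "y \<in> principal_ideal u" for y c
    using assms that by (auto simp: lattice_hom_on_def)
  show "\<phi> (c *\<^sub>R x) = c * \<phi> x" using scale x .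
  have neg: "\<phi> (- y) = - \<phi> y" if "y \<in> principal_ideal u" for y
    using scale[OF that, of "-1"] by simp
  show "\<phi> (- x) = - \<phi> x" using neg x .
  show "\<phi> (x - y) = \<phi> x - \<phi> y" if "y \<in> principal_ideal u" for y
    using add[of "- y"] neg[OF that] principal_ideal_minus[OF that] by simp
  show "\<phi> (labs x) = \<bar>\<phi> x\<bar>"
    using sup[of "- x"] neg[OF x] principal_ideal_minus[OF x] by (auto simp: labs_def)
qed

lemma lattice_hom_on_0: "lattice_hom_on (principal_ideal u) \<phi> \<Longrightarrow> \<phi> 0 = 0"
  using lattice_hom_onD(3)[of u \<phi> 0 0] by (simp add: principal_ideal_0)

lemma lattice_hom_on_mono:
  assumes "lattice_hom_on (principal_ideal u) \<phi>" "x \<in> principal_ideal u" "y \<in> principal_ideal u" "x \<le> y"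
  shows "\<phi> x \<le> \<phi> y"
  using lattice_hom_onD(2)[OF assms(1-3)] assms(4) by (simp add: sup_absorb2)

text \<open>Separation applied to \<open>a - b\<close>. Later comparisons of calculus expressions in
  the lattice are reduced by it to inequalities between real numbers.\<close>

lemma le_by_lattice_hom:
  fixes u :: "'a::banach_lattice"
  assumes "0 \<le> u" "a \<in> principal_ideal u" "b \<in> principal_ideal u"
    and "\<And>\<phi>. lattice_hom_on (principal_ideal u) \<phi> \<Longrightarrow> \<phi> a \<le> \<phi> b"
  shows "a \<le> b"
proof -
  have "a - b \<le> 0"
    using assms by (intro lattice_hom_separation[of u]) (auto intro: principal_ideal_diff simp: lattice_hom_onD)
  thus ?thesis by simp
qed

lemma eq_by_lattice_hom:
  fixes u :: "'a::banach_lattice"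
  assumes "0 \<le> u" "a \<in> principal_ideal u" "b \<in> principal_ideal u"
    and "\<And>\<phi>. lattice_hom_on (principal_ideal u) \<phi> \<Longrightarrow> \<phi> a = \<phi> b"
  shows "a = b"
  using le_by_lattice_hom[OF assms(1-3)] le_by_lattice_hom[OF assms(1,3,2)] assms(4)
  by (metis antisym order_refl)

subsection \<open>Krivine functional calculus\<close>

text \<open>The functions on which the value of a \<open>krivine_hom\<close> is forced by its values
  at \<open>fst\<close> and \<open>snd\<close>. Minima are covered as negated maxima of negated
  functions.\<close>

inductive_set lattice_linear :: "(real \<times> real \<Rightarrow> real) set" where
  fst: "fst \<in> lattice_linear"
| snd: "snd \<in> lattice_linear"
| add: "g \<in> lattice_linear \<Longrightarrow> h \<in> lattice_linear \<Longrightarrow> (\<lambda>u. g u + h u) \<in> lattice_linear"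
| scale: "g \<in> lattice_linear \<Longrightarrow> (\<lambda>u. c * g u) \<in> lattice_linear"
| max: "g \<in> lattice_linear \<Longrightarrow> h \<in> lattice_linear \<Longrightarrow> (\<lambda>u. max (g u) (h u)) \<in> lattice_linear"

lemma H2_fst: "fst \<in> H2" and H2_snd: "snd \<in> H2"
  by (auto simp: H2_def intro!: continuous_intros)

lemma H2_add: "g \<in> H2 \<Longrightarrow> h \<in> H2 \<Longrightarrow> (\<lambda>u. g u + h u) \<in> H2"
  and H2_scale: "g \<in> H2 \<Longrightarrow> (\<lambda>u. c * g u) \<in> H2"
  and H2_max: "g \<in> H2 \<Longrightarrow> h \<in> H2 \<Longrightarrow> (\<lambda>u. max (g u) (h u)) \<in> H2"
  by (auto simp: H2_def distrib_left max_mult_distrib_left intro!: continuous_intros)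

lemma lattice_linear_H2: "g \<in> lattice_linear \<Longrightarrow> g \<in> H2"
  by (induction rule: lattice_linear.induct) (auto intro: H2_fst H2_snd H2_add H2_scale H2_max)

lemma H2_0: "f \<in> H2 \<Longrightarrow> f (0, 0) = 0"
  unfolding H2_def by (metis (mono_tags, lifting) mem_Collect_eq mult_zero_left order_refl)

text \<open>Finitely many of the open sets where some \<open>g\<close> exceeds \<open>f\<close>
  cover \<open>S\<close>, and the maximum of these \<open>g\<close> exceeds \<open>f\<close>
  throughout \<open>S\<close>.\<close>

lemma max_closed_exceeds_on_compact:
  fixes f :: "'b::topological_space \<Rightarrow> real"
  assumes S: "compact S" "S \<noteq> {}" and f: "continuous_on UNIV f"
    and cont: "\<And>g. g \<in> L \<Longrightarrow> continuous_on UNIV g"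
    and max: "\<And>g h. g \<in> L \<Longrightarrow> h \<in> L \<Longrightarrow> (\<lambda>x. max (g x) (h x)) \<in> L"
    and pt: "\<And>b. b \<in> S \<Longrightarrow> \<exists>g\<in>L. f b < g b"
  shows "\<exists>g\<in>L. \<forall>x\<in>S. f x < g x"
proof -
  have "open {x. f x < g x}" if "g \<in> L" for g
    using f cont[OF that] by (rule open_Collect_less)
  then obtain F where F: "F \<subseteq> L" "finite F" "S \<subseteq> (\<Union>g\<in>F. {x. f x < g x})"
  proof (rule compactE_image[OF S(1), of L "\<lambda>g. {x. f x < g x}"])
    show "S \<subseteq> (\<Union>g\<in>L. {x. f x < g x})" using pt by blast
  qed
  have "F \<noteq> {}" using F(3) S(2) by auto
  from F(2) this F(1) have "\<exists>h\<in>L. \<forall>x. \<forall>g\<in>F. g x \<le> h x"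
  proof (induction rule: finite_ne_induct)
    case (singleton g)
    thus ?case by auto
  next
    case (insert g F)
    then obtain h where h: "h \<in> L" "\<forall>x. \<forall>g\<in>F. g x \<le> h x" by auto
    show ?case
      by (rule bexI[of _ "\<lambda>x. max (g x) (h x)"]) (use h insert.prems max in \<open>auto simp: le_max_iff_disj\<close>)
  qed
  then obtain h where h: "h \<in> L" "\<forall>x. \<forall>g\<in>F. g x \<le> h x" by blast
  have "f x < h x" if "x \<in> S" for x
  proof -
    obtain g where "g \<in> F" "f x < g x" using F(3) \<open>x \<in> S\<close> by blast
    thus ?thesis using h(2) less_le_trans by blast
  qed
  thus ?thesis using h(1) by blast
qed

text \<open>Two rounds of compactness. For fixed \<open>a\<close>, maxima of functions interpolating
  at \<open>a\<close> and a second point give a member above \<open>f - e\<close> on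
  \<open>S\<close> that still equals \<open>f\<close> at \<open>a\<close>. Minima of such members
  then come below \<open>f + e\<close> everywhere.\<close>

lemma kakutani_stone:
  fixes f :: "'b::topological_space \<Rightarrow> real"
  assumes S: "compact S" "S \<noteq> {}" and f: "continuous_on UNIV f"
    and cont: "\<And>g. g \<in> L \<Longrightarrow> continuous_on UNIV g"
    and max: "\<And>g h. g \<in> L \<Longrightarrow> h \<in> L \<Longrightarrow> (\<lambda>x. max (g x) (h x)) \<in> L"
    and min: "\<And>g h. g \<in> L \<Longrightarrow> h \<in> L \<Longrightarrow> (\<lambda>x. min (g x) (h x)) \<in> L"
    and interpol: "\<And>a b. a \<in> S \<Longrightarrow> b \<in> S \<Longrightarrow> \<exists>g\<in>L. g a = f a \<and> g b = f b"
    and e: "e > 0"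
  shows "\<exists>g\<in>L. \<forall>x\<in>S. \<bar>f x - g x\<bar> < e"
proof -
  have above: "\<exists>g\<in>{g\<in>L. g a = f a}. \<forall>x\<in>S. f x - e < g x" if a: "a \<in> S" for a
  proof (rule max_closed_exceeds_on_compact[OF S])
    show "\<exists>g\<in>{g \<in> L. g a = f a}. f b - e < g b" if "b \<in> S" for b
      using interpol[OF a that] e by force
  qed (use f cont max in \<open>auto intro!: continuous_intros\<close>)
  \<comment> \<open>The minima are treated as maxima of negated functions, so the same covering
    lemma applies to \<open>- f\<close>. The side condition \<open>f x - e < g x\<close> survives
    minima.\<close>
  have "\<exists>g\<in>{\<lambda>x. - g x |g. g \<in> L \<and> (\<forall>x\<in>S. f x - e < g x)}. \<forall>x\<in>S. - f x - e < g x"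
  proof (rule max_closed_exceeds_on_compact[OF S])
    fix g h assume "g \<in> {\<lambda>x. - g x |g. g \<in> L \<and> (\<forall>x\<in>S. f x - e < g x)}"
      "h \<in> {\<lambda>x. - g x |g. g \<in> L \<and> (\<forall>x\<in>S. f x - e < g x)}"
    then obtain g' h' where gh: "g = (\<lambda>x. - g' x)" "h = (\<lambda>x. - h' x)" "g' \<in> L" "h' \<in> L"
      "\<forall>x\<in>S. f x - e < g' x" "\<forall>x\<in>S. f x - e < h' x" by blast
    have "(\<lambda>x. max (g x) (h x)) = (\<lambda>x. - min (g' x) (h' x))" unfolding gh by (auto simp: max_def min_def)
    moreover have "(\<lambda>x. min (g' x) (h' x)) \<in> L" using min gh by blast
    moreover have "\<forall>x\<in>S. f x - e < min (g' x) (h' x)" using gh by auto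
    ultimately show "(\<lambda>x. max (g x) (h x)) \<in> {\<lambda>x. - g x |g. g \<in> L \<and> (\<forall>x\<in>S. f x - e < g x)}"
      by (auto intro!: exI[of _ "\<lambda>x. min (g' x) (h' x)"])
  next
    fix b assume "b \<in> S"
    with above obtain g where g: "g \<in> L" "g b = f b" "\<forall>x\<in>S. f x - e < g x" by blast
    show "\<exists>g\<in>{\<lambda>x. - g x |g. g \<in> L \<and> (\<forall>x\<in>S. f x - e < g x)}. - f b - e < g b"
      by (rule bexI[of _ "\<lambda>x. - g x"]) (use g e in auto)
  qed (use f cont in \<open>auto intro!: continuous_intros\<close>)
  then obtain g where g: "g \<in> L" "\<forall>x\<in>S. f x - e < g x" "\<forall>x\<in>S. - f x - e < - g x" by blast
  show ?thesis by (rule bexI[OF _ g(1)]) (use g in \<open>fastforce simp: abs_less_iff\<close>)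
qed

text \<open>Linearly independent points are interpolated by a linear function. Dependent points of
  the l1 sphere are equal or opposite; opposite ones are handled separately by the positive and
  negative parts of one linear functional.\<close>

lemma lattice_linear_interpolation:
  fixes a b :: "real \<times> real"
  assumes a: "\<bar>fst a\<bar> + \<bar>snd a\<bar> = 1" and b: "\<bar>fst b\<bar> + \<bar>snd b\<bar> = 1"
  shows "\<exists>g\<in>lattice_linear. g a = f a \<and> g b = f b"
proof -
  obtain a1 a2 b1 b2 where ab: "a = (a1, a2)" "b = (b1, b2)" by (metis surj_pair)
  define D where "D = a1 * b2 - a2 * b1"
  have lin: "(\<lambda>u. c * fst u + d * snd u) \<in> lattice_linear" for c d
    by (intro lattice_linear.intros)
  show ?thesis
  proof (cases "D = 0")
    case False
    \<comment> \<open>Cramer's rule with determinant \<open>D\<close>.\<close>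
    define c where "c = (f a * b2 - f b * a2) / D"
    define d where "d = (f b * a1 - f a * b1) / D"
    have "D * (c * a1 + d * a2) = D * f a" "D * (c * b1 + d * b2) = D * f b"
      using False by (auto simp: c_def d_def distrib_left) (auto simp: D_def algebra_simps)
    thus ?thesis using False ab by (intro bexI[OF _ lin[of c d]]) auto
  next
    case True
    \<comment> \<open>The functional norming \<open>a\<close>: its value there is the l1 norm of
      \<open>a\<close>, that is 1.\<close>
    define l where "l u = sgn a1 * fst u + sgn a2 * snd u" for u :: "real \<times> real"
    have l: "l \<in> lattice_linear" unfolding l_def by (rule lin)
    have la: "l a = 1" using a by (simp add: l_def ab abs_sgn mult.commute)
    define k where "k = l b"
    have "b1 = (\<bar>a1\<bar> + \<bar>a2\<bar>) * b1" "b2 = (\<bar>a1\<bar> + \<bar>a2\<bar>) * b2" using a ab by auto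
    moreover have "a2 * b1 = a1 * b2" using True by (simp add: D_def)
    hence "\<bar>a2\<bar> * b1 = (sgn a2 * b2) * a1" "\<bar>a1\<bar> * b2 = (sgn a1 * b1) * a2"
      by (simp_all add: abs_sgn mult.assoc mult.commute mult.left_commute)
    ultimately have bk: "b1 = k * a1" "b2 = k * a2"
      by (simp_all add: k_def l_def ab distrib_right) (simp_all add: abs_sgn mult.commute mult.left_commute)
    have "\<bar>k\<bar> * (\<bar>a1\<bar> + \<bar>a2\<bar>) = 1" using b by (simp add: ab bk abs_mult distrib_left)
    hence "k = 1 \<or> k = -1" using a ab by auto
    moreover have ?thesis if "k = 1"
      by (rule bexI[of _ "\<lambda>u. f a * l u"]) (use that la ab bk l in \<open>auto intro: lattice_linear.scale\<close>)
    moreover have ?thesis if "k = -1"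
    proof (rule bexI)
      \<comment> \<open>The zero function is written \<open>0 * l u\<close>, as
        \<open>lattice_linear\<close> has no constants among its generators. At \<open>a\<close>
        only the first summand survives, at \<open>b\<close> only the second.\<close>
      let ?g = "\<lambda>u. f a * max (l u) (0 * l u) + f b * max ((-1) * l u) (0 * l u)"
      show "?g a = f a \<and> ?g b = f b" unfolding k_def[symmetric] la that by simp
      show "?g \<in> lattice_linear" by (intro lattice_linear.intros l)
    qed
    ultimately show ?thesis by blast
  qed
qed

text \<open>Uniform approximation on the compact l1 sphere extends to the plane by homogeneity, with
  error proportional to the l1 norm.\<close>

lemma lattice_linear_dense:
  assumes f: "f \<in> H2" and e: "e > 0"
  shows "\<exists>g\<in>lattice_linear. \<forall>s t. \<bar>f (s, t) - g (s, t)\<bar> \<le> e * (\<bar>s\<bar> + \<bar>t\<bar>)"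
proof -
  define S where "S = {u :: real \<times> real. \<bar>fst u\<bar> + \<bar>snd u\<bar> = 1}"
  have "closed S" unfolding S_def by (intro closed_Collect_eq continuous_intros)
  moreover have "S \<subseteq> {-1..1} \<times> {-1..1}" by (auto simp: S_def)
  hence "bounded S" by (rule bounded_subset[rotated]) (intro bounded_Times bounded_closed_interval)
  ultimately have "compact S" by (simp add: compact_eq_bounded_closed)
  moreover have "S \<noteq> {}" 
  proof -
    have "(1, 0) \<in> S" by (simp add: S_def)
    thus ?thesis by blast
  qed
  moreover have "(\<lambda>x. min (g x) (h x)) \<in> lattice_linear"
    if "g \<in> lattice_linear" "h \<in> lattice_linear" for g h
  proof -
    have "(\<lambda>x. (-1) * max ((-1) * g x) ((-1) * h x)) \<in> lattice_linear"
      using that by (intro lattice_linear.intros)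
    also have "(\<lambda>x. (-1) * max ((-1) * g x) ((-1) * h x)) = (\<lambda>x. min (g x) (h x))"
      by (auto simp: max_def min_def)
    finally show ?thesis .
  qed
  ultimately have "\<exists>g\<in>lattice_linear. \<forall>x\<in>S. \<bar>f x - g x\<bar> < e"
    using f e lattice_linear_H2
    by (intro kakutani_stone) (auto simp: H2_def S_def intro: lattice_linear.max lattice_linear_interpolation)
  then obtain g where g: "g \<in> lattice_linear" "\<And>x. x \<in> S \<Longrightarrow> \<bar>f x - g x\<bar> < e" by blast
  have "\<bar>f (s, t) - g (s, t)\<bar> \<le> e * (\<bar>s\<bar> + \<bar>t\<bar>)" for s t
  proof (cases "s = 0 \<and> t = 0")
    case True
    thus ?thesis using H2_0[OF f] H2_0[OF lattice_linear_H2[OF g(1)]] by simp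
  next
    case False
    define r where "r = \<bar>s\<bar> + \<bar>t\<bar>"
    have r: "r > 0" using False by (auto simp: r_def)
    have hom: "h (s, t) = r * h (s / r, t / r)" if h: "h \<in> H2" for h
    proof -
      have "\<forall>t a b. t \<ge> 0 \<longrightarrow> h (t * a, t * b) = t * h (a, b)" using h by (simp add: H2_def)
      from this[rule_format, of r "s / r" "t / r"] show ?thesis using r by simp
    qed
    have "(s / r, t / r) \<in> S" using r by (simp add: S_def add_divide_distrib[symmetric]) (simp add: r_def)
    hence "\<bar>f (s / r, t / r) - g (s / r, t / r)\<bar> < e" by (rule g(2))
    moreover have "\<bar>f (s, t) - g (s, t)\<bar> = r * \<bar>f (s / r, t / r) - g (s / r, t / r)\<bar>"
      using hom[OF f] hom[OF lattice_linear_H2[OF g(1)]] r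
      by (metis abs_mult abs_of_pos right_diff_distrib)
    ultimately show ?thesis using r by (simp add: r_def mult.commute)
  qed
  thus ?thesis using g(1) by blast
qed

lemma krivine_homD:
  assumes "krivine_hom x y T"
  shows "g \<in> H2 \<Longrightarrow> h \<in> H2 \<Longrightarrow> T (\<lambda>u. g u + h u) = T g + T h"
    and "g \<in> H2 \<Longrightarrow> T (\<lambda>u. c * g u) = c *\<^sub>R T g"
    and "g \<in> H2 \<Longrightarrow> h \<in> H2 \<Longrightarrow> T (\<lambda>u. max (g u) (h u)) = sup (T g) (T h)"
    and "T fst = x" and "T snd = y"
  using assms unfolding krivine_hom_def by blast+

text \<open>Both maps agree on \<open>lattice_linear\<close> by induction and are monotone because
  they preserve maxima, so density and the Archimedean property compare them on \<open>H2\<close>.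
  Exchanging the two gives the uniqueness behind the definite description in
  \<open>krivine2\<close>.\<close>

lemma krivine_hom_unique_le:
  fixes x y :: "'a::banach_lattice"
  assumes T: "krivine_hom x y T" and T': "krivine_hom x y T'" and f: "f \<in> H2"
  shows "T f \<le> T' f"
proof -
  have agree: "T g = T' g" if "g \<in> lattice_linear" for g
    using that
  proof (induction rule: lattice_linear.induct)
    case (add g h)
    thus ?case using krivine_homD(1)[OF T] krivine_homD(1)[OF T'] lattice_linear_H2 by metis
  next
    case (max g h)
    thus ?case using krivine_homD(3)[OF T] krivine_homD(3)[OF T'] lattice_linear_H2 by metis
  next
    case (scale g c)
    thus ?case using krivine_homD(2)[OF T] krivine_homD(2)[OF T'] lattice_linear_H2 by metis
  qed (use krivine_homD[OF T] krivine_homD[OF T'] in simp_all)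
  have mono: "R g \<le> R h" if R: "krivine_hom x y R" and gh: "g \<in> H2" "h \<in> H2" "\<And>u. g u \<le> h u" for R g h
  proof -
    have "(\<lambda>u. max (g u) (h u)) = h" using gh(3) by (auto simp: max_def)
    moreover have "R (\<lambda>u. max (g u) (h u)) = sup (R g) (R h)"
      by (rule krivine_homD(3)[OF R gh(1,2)])
    ultimately show ?thesis by (metis sup.cobounded1)
  qed
  \<comment> \<open>The l1 norm in lattice-linear form: the approximation error is a multiple of
    \<open>n\<close>, and both maps take the same value at \<open>n\<close>.\<close>
  define n where "n u = max (fst u) ((-1) * fst u) + max (snd u) ((-1) * snd u)" for u :: "real \<times> real"
  have n: "n \<in> lattice_linear" unfolding n_def by (intro lattice_linear.intros)
  have n_eq: "n (s, t) = \<bar>s\<bar> + \<bar>t\<bar>" for s t by (auto simp: n_def)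
  have "T f - T' f \<le> 0"
  proof (rule le_0_if_le_scaleR)
    fix e :: real assume "e > 0"
    \<comment> \<open>One half of \<open>e\<close> pays for passing from \<open>f\<close> to
      \<open>g\<close> under \<open>T\<close>, the other for returning from \<open>g\<close> to
      \<open>f\<close> under \<open>T'\<close>.\<close>
    define d where "d = e / 2"
    have "d > 0" "e = d + d" using \<open>e > 0\<close> by (auto simp: d_def)
    obtain g where g: "g \<in> lattice_linear" "\<And>s t. \<bar>f (s, t) - g (s, t)\<bar> \<le> d * (\<bar>s\<bar> + \<bar>t\<bar>)"
      using lattice_linear_dense[OF f \<open>d > 0\<close>] by blast
    note H = f lattice_linear_H2[OF g(1)] lattice_linear_H2[OF n]
    have lin: "R (\<lambda>u. h u + d * n u) = R h + d *\<^sub>R R n"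
      if "krivine_hom x y R" "h \<in> H2" for R h
      using krivine_homD(1)[OF that H2_scale[OF H(3)]] krivine_homD(2)[OF that(1) H(3)] by simp
    have le: "f u \<le> g u + d * n u" "g u \<le> f u + d * n u" for u
      using g(2)[of "fst u" "snd u"] n_eq[of "fst u" "snd u"] by (auto simp: abs_le_iff)
    have "T f \<le> T (\<lambda>u. g u + d * n u)"
      by (rule mono[OF T]) (intro H H2_add H2_scale le)+
    hence "T f \<le> T g + d *\<^sub>R T n" using lin[OF T H(2)] by simp
    moreover have "T' g \<le> T' (\<lambda>u. f u + d * n u)"
      by (rule mono[OF T']) (intro H H2_add H2_scale le)+
    hence "T g \<le> T' f + d *\<^sub>R T n" using lin[OF T' H(1)] agree[OF g(1)] agree[OF n] by simp
    hence "T g + d *\<^sub>R T n \<le> T' f + d *\<^sub>R T n + d *\<^sub>R T n" by simp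
    ultimately have "T f \<le> T' f + (d *\<^sub>R T n + d *\<^sub>R T n)"
      unfolding add.assoc by (rule order_trans)
    thus "T f - T' f \<le> e *\<^sub>R T n"
      unfolding \<open>e = d + d\<close> scaleR_add_left by (simp add: diff_le_eq add.commute)
  qed
  thus ?thesis by simp
qed

text \<open>For lattice-linear functions the same operations are carried out in the lattice.
  Approximants of a general \<open>f\<close> are close in order because homomorphisms detect it,
  hence Cauchy in norm, and completeness gives the element.\<close>

lemma ex_homogeneous_calculus:
  fixes u x y :: "'a::banach_lattice"
  assumes u: "0 \<le> u" and x: "x \<in> principal_ideal u" and y: "y \<in> principal_ideal u" and f: "f \<in> H2"
  shows "\<exists>z\<in>principal_ideal u. \<forall>\<phi>. lattice_hom_on (principal_ideal u) \<phi> \<longrightarrow> \<phi> z = f (\<phi> x, \<phi> y)"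
proof -
  \<comment> \<open>The unit for all errors: \<open>\<phi> v\<close> is exactly the l1 norm of
    \<open>(\<phi> x, \<phi> y)\<close>.\<close>
  define v where "v = labs x + labs y"
  note I = principal_ideal_intros[where u = u]
  have v: "v \<in> principal_ideal u" using x y by (simp add: v_def I)
  have \<phi>v: "\<phi> v = \<bar>\<phi> x\<bar> + \<bar>\<phi> y\<bar>" if "lattice_hom_on (principal_ideal u) \<phi>" for \<phi>
    using that x y by (simp add: v_def lattice_hom_onD I)
  have lin: "\<exists>z\<in>principal_ideal u. \<forall>\<phi>. lattice_hom_on (principal_ideal u) \<phi> \<longrightarrow> \<phi> z = g (\<phi> x, \<phi> y)"
    if "g \<in> lattice_linear" for g
    using that
  proof (induction rule: lattice_linear.induct)
    case fst
    thus ?case using x by auto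
  next
    case snd
    thus ?case using y by auto
  next
    case (add g h)
    then obtain z w where "z \<in> principal_ideal u" "w \<in> principal_ideal u"
      "\<forall>\<phi>. lattice_hom_on (principal_ideal u) \<phi> \<longrightarrow> \<phi> z = g (\<phi> x, \<phi> y)"
      "\<forall>\<phi>. lattice_hom_on (principal_ideal u) \<phi> \<longrightarrow> \<phi> w = h (\<phi> x, \<phi> y)" by blast
    thus ?case by (intro bexI[of _ "z + w"]) (auto simp: lattice_hom_onD I)
  next
    case (scale g c)
    then obtain z where "z \<in> principal_ideal u"
      "\<forall>\<phi>. lattice_hom_on (principal_ideal u) \<phi> \<longrightarrow> \<phi> z = g (\<phi> x, \<phi> y)" by blast
    thus ?case by (intro bexI[of _ "c *\<^sub>R z"]) (auto simp: lattice_hom_onD I)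
  next
    case (max g h)
    then obtain z w where "z \<in> principal_ideal u" "w \<in> principal_ideal u"
      "\<forall>\<phi>. lattice_hom_on (principal_ideal u) \<phi> \<longrightarrow> \<phi> z = g (\<phi> x, \<phi> y)"
      "\<forall>\<phi>. lattice_hom_on (principal_ideal u) \<phi> \<longrightarrow> \<phi> w = h (\<phi> x, \<phi> y)" by blast
    thus ?case by (intro bexI[of _ "sup z w"]) (auto simp: lattice_hom_onD I)
  qed
  define e :: "nat \<Rightarrow> real" where "e n = (1/2) ^ n" for n
  have e: "0 < e n" "m \<ge> n \<Longrightarrow> e m \<le> e n" for m n by (auto simp: e_def intro: power_decreasing)
  have e0: "e \<longlonglongrightarrow> 0" unfolding e_def by (intro LIMSEQ_power_zero) auto
  have "\<exists>z\<in>principal_ideal u. \<forall>\<phi>. lattice_hom_on (principal_ideal u) \<phi> \<longrightarrow>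
      \<bar>f (\<phi> x, \<phi> y) - \<phi> z\<bar> \<le> e n * \<phi> v" for n
  proof -
    obtain g where g: "g \<in> lattice_linear" "\<And>s t. \<bar>f (s, t) - g (s, t)\<bar> \<le> e n * (\<bar>s\<bar> + \<bar>t\<bar>)"
      using lattice_linear_dense[OF f e(1)] by blast
    obtain z where z: "z \<in> principal_ideal u"
      and \<phi>z: "\<And>\<phi>. lattice_hom_on (principal_ideal u) \<phi> \<Longrightarrow> \<phi> z = g (\<phi> x, \<phi> y)"
      using lin[OF g(1)] by blast
    have "\<bar>f (\<phi> x, \<phi> y) - \<phi> z\<bar> \<le> e n * \<phi> v" if \<phi>: "lattice_hom_on (principal_ideal u) \<phi>" for \<phi>
      unfolding \<phi>z[OF \<phi>] \<phi>v[OF \<phi>] by (rule g(2))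
    thus ?thesis using z by blast
  qed
  then obtain z where z: "\<And>n. z n \<in> principal_ideal u"
    and \<phi>z: "\<And>n \<phi>. lattice_hom_on (principal_ideal u) \<phi> \<Longrightarrow> \<bar>f (\<phi> x, \<phi> y) - \<phi> (z n)\<bar> \<le> e n * \<phi> v"
    unfolding Bex_def by (elim choice[OF allI, THEN exE]) blast
  have diff: "labs (z m - z n) \<le> (2 * e N) *\<^sub>R v" if "m \<ge> N" "n \<ge> N" for m n N
  proof (rule le_by_lattice_hom[OF u])
    show "labs (z m - z n) \<in> principal_ideal u" "(2 * e N) *\<^sub>R v \<in> principal_ideal u"
      by (intro I z v)+
    fix \<phi> assume \<phi>: "lattice_hom_on (principal_ideal u) \<phi>"
    have "0 \<le> \<phi> v" using \<phi>v[OF \<phi>] by simp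
    hence "e m * \<phi> v \<le> e N * \<phi> v" "e n * \<phi> v \<le> e N * \<phi> v" using e(2) that by (auto intro: mult_right_mono)
    hence "\<bar>\<phi> (z m) - \<phi> (z n)\<bar> \<le> 2 * e N * \<phi> v" using \<phi>z[OF \<phi>, of m] \<phi>z[OF \<phi>, of n] by linarith
    thus "\<phi> (labs (z m - z n)) \<le> \<phi> ((2 * e N) *\<^sub>R v)"
      using z v by (simp add: lattice_hom_onD[OF \<phi>] I)
  qed
  have "Cauchy z"
  proof (rule CauchyI)
    fix r :: real assume r: "0 < r"
    have "(\<lambda>N. 2 * e N * norm v) \<longlonglongrightarrow> 2 * 0 * norm v" by (intro tendsto_intros e0)
    then obtain N where N: "2 * e N * norm v < r"
      using order_tendstoD(2)[of _ "2 * 0 * norm v" sequentially r] r eventually_happens'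
      by (metis (mono_tags, lifting) mult_zero_left mult_zero_right sequentially_bot)
    have "norm (z m - z n) < r" if "m \<ge> N" "n \<ge> N" for m n
      using norm_le_of_labs_le[OF diff[OF that]] N e(1)[of N] by simp
    thus "\<exists>M. \<forall>m\<ge>M. \<forall>n\<ge>M. norm (z m - z n) < r" by blast
  qed
  then obtain l where l: "z \<longlonglongrightarrow> l" by (auto simp: Cauchy_convergent_iff convergent_def)
  \<comment> \<open>The limit is estimated in order, not only in norm, since \<open>\<phi>\<close>
    is known to be monotone but not assumed norm continuous.\<close>
  have lz: "labs (l - z n) \<le> (2 * e n) *\<^sub>R v" for n
    unfolding labs_le_iff
  proof
    show "l - z n \<le> (2 * e n) *\<^sub>R v"
    proof (rule lattice_limit_le)
      show "(\<lambda>m. z m - z n) \<longlonglongrightarrow> l - z n" by (intro tendsto_intros l)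
    qed (use diff[of n _ n] in \<open>auto simp: labs_le_iff\<close>)
    show "- (l - z n) \<le> (2 * e n) *\<^sub>R v"
    proof (rule lattice_limit_le)
      show "(\<lambda>m. - (z m - z n)) \<longlonglongrightarrow> - (l - z n)" by (intro tendsto_intros l)
    qed (use diff[of n _ n] in \<open>auto simp: labs_le_iff\<close>)
  qed
  have "l - z 0 \<in> principal_ideal u" by (rule principal_ideal_solid[OF lz]) (intro I v)
  hence lI: "l \<in> principal_ideal u" using I(1)[OF _ z[of 0]] by force
  have "\<phi> l = f (\<phi> x, \<phi> y)" if \<phi>: "lattice_hom_on (principal_ideal u) \<phi>" for \<phi>
  proof -
    have "\<bar>\<phi> l - f (\<phi> x, \<phi> y)\<bar> \<le> 3 * e n * \<phi> v" for n
    proof -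
      have "\<phi> (labs (l - z n)) \<le> \<phi> ((2 * e n) *\<^sub>R v)"
        by (intro lattice_hom_on_mono[OF \<phi>] lz I lI z v)
      hence "\<bar>\<phi> l - \<phi> (z n)\<bar> \<le> 2 * e n * \<phi> v" using lI z v by (simp add: lattice_hom_onD[OF \<phi>] I)
      thus ?thesis using \<phi>z[OF \<phi>, of n] by linarith
    qed
    moreover have "(\<lambda>n. 3 * e n * \<phi> v) \<longlonglongrightarrow> 3 * 0 * \<phi> v" by (intro tendsto_intros e0)
    ultimately have "\<bar>\<phi> l - f (\<phi> x, \<phi> y)\<bar> \<le> 3 * 0 * \<phi> v" by (intro LIMSEQ_le_const) auto
    thus ?thesis by simp
  qed
  thus ?thesis using lI by blast
qed

text \<open>Choosing an element for every \<open>g \<in> H2\<close> defines a map, which is a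
  \<open>krivine_hom\<close> because its laws hold under every \<open>\<phi>\<close>. Uniqueness
  identifies its value at \<open>f\<close> with \<open>krivine2 x y f\<close>.\<close>

lemma krivine2_spec:
  fixes u x y :: "'a::banach_lattice"
  assumes u: "0 \<le> u" and x: "x \<in> principal_ideal u" and y: "y \<in> principal_ideal u" and f: "f \<in> H2"
  shows "krivine2 x y f \<in> principal_ideal u \<and>
    (\<forall>\<phi>. lattice_hom_on (principal_ideal u) \<phi> \<longrightarrow> \<phi> (krivine2 x y f) = f (\<phi> x, \<phi> y))"
proof -
  have "\<forall>g\<in>H2. \<exists>z\<in>principal_ideal u. \<forall>\<phi>. lattice_hom_on (principal_ideal u) \<phi> \<longrightarrow> \<phi> z = g (\<phi> x, \<phi> y)"
    using ex_homogeneous_calculus[OF u x y] by blast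
  then obtain T where T: "\<And>g. g \<in> H2 \<Longrightarrow> T g \<in> principal_ideal u"
    "\<And>g \<phi>. g \<in> H2 \<Longrightarrow> lattice_hom_on (principal_ideal u) \<phi> \<Longrightarrow> \<phi> (T g) = g (\<phi> x, \<phi> y)"
    unfolding Bex_def by (elim bchoice[THEN exE]) blast
  note I = principal_ideal_intros[where u = u]
  have hom: "krivine_hom x y T" unfolding krivine_hom_def
  proof (intro conjI ballI allI)
    fix g h assume gh: "g \<in> H2" "h \<in> H2"
    note gh' = H2_add[OF gh] H2_max[OF gh]
    show "T (\<lambda>u. g u + h u) = T g + T h"
    proof (rule eq_by_lattice_hom[OF u])
      fix \<phi> assume \<phi>: "lattice_hom_on (principal_ideal u) \<phi>"
      show "\<phi> (T (\<lambda>u. g u + h u)) = \<phi> (T g + T h)"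
        using T(1)[OF gh(1)] T(1)[OF gh(2)] by (simp add: lattice_hom_onD[OF \<phi>] T(2)[OF _ \<phi>] gh gh')
    qed (intro T gh gh' I)+
    show "T (\<lambda>u. max (g u) (h u)) = sup (T g) (T h)"
    proof (rule eq_by_lattice_hom[OF u])
      fix \<phi> assume \<phi>: "lattice_hom_on (principal_ideal u) \<phi>"
      show "\<phi> (T (\<lambda>u. max (g u) (h u))) = \<phi> (sup (T g) (T h))"
        using T(1)[OF gh(1)] T(1)[OF gh(2)] by (simp add: lattice_hom_onD[OF \<phi>] T(2)[OF _ \<phi>] gh gh')
    qed (intro T gh gh' I)+
  next
    fix g c assume g: "g \<in> H2"
    show "T (\<lambda>u. c * g u) = c *\<^sub>R T g"
    proof (rule eq_by_lattice_hom[OF u])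
      fix \<phi> assume \<phi>: "lattice_hom_on (principal_ideal u) \<phi>"
      show "\<phi> (T (\<lambda>u. c * g u)) = \<phi> (c *\<^sub>R T g)"
        using T(1)[OF g] by (simp add: lattice_hom_onD[OF \<phi>] T(2)[OF _ \<phi>] g H2_scale)
    qed (intro T g H2_scale I)+
  next
    show "T fst = x"
      by (rule eq_by_lattice_hom[OF u T(1)[OF H2_fst] x]) (simp add: T(2)[OF H2_fst])
    show "T snd = y"
      by (rule eq_by_lattice_hom[OF u T(1)[OF H2_snd] y]) (simp add: T(2)[OF H2_snd])
  qed
  have "krivine2 x y f = T f" unfolding krivine2_def
  proof (rule the_equality)
    show "z = T f" if "\<exists>T. krivine_hom x y T \<and> z = T f" for z
      using that krivine_hom_unique_le[OF hom _ f] krivine_hom_unique_le[OF _ hom f] by (blast intro: antisym)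
  qed (use hom in blast)
  thus ?thesis using T(1)[OF f] T(2)[OF f] by simp
qed

lemmas krivine2_ideal = krivine2_spec[THEN conjunct1]
  and lattice_hom_krivine2 = krivine2_spec[THEN conjunct2, rule_format]

subsection \<open>Scalar inequalities\<close>

text \<open>Where the maximum is positive, scaling to \<open>norm b = 1\<close> puts
  \<open>a\<close> in the ball of radius \<open>1 / \<eta>\<close>. On that compact set the positive
  gap \<open>h (a, b) - norm a\<close> attains its minimum, which serves as \<open>c\<close>.
  Euclidean arguments cover the real and the complex uses alike.\<close>

lemma homogeneous_gain:
  fixes h :: "'v::euclidean_space \<times> 'v \<Rightarrow> real"
  assumes cont: "continuous_on UNIV h"
    and hom: "\<And>r a b. r > 0 \<Longrightarrow> h (r *\<^sub>R a, r *\<^sub>R b) = r * h (a, b)"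
    and ge: "\<And>a b. norm a \<le> h (a, b)"
    and gt: "\<And>a b. b \<noteq> 0 \<Longrightarrow> norm a < h (a, b)"
    and \<eta>: "\<eta> > 0"
  shows "\<exists>c>0. \<forall>a b. norm a + c * max (norm b - \<eta> * norm a) 0 \<le> h (a, b)"
proof -
  define S where "S = cball (0::'v) (1 / \<eta>) \<times> sphere (0::'v) 1"
  have "compact S" unfolding S_def by (intro compact_Times) auto
  moreover obtain b0 :: 'v where "norm b0 = 1" using vector_choose_size[of 1] by auto
  hence "(0, b0) \<in> S" using \<eta> by (simp add: S_def)
  hence "S \<noteq> {}" by blast
  moreover have "continuous_on S (\<lambda>u. h u - norm (fst u))"
    by (intro continuous_intros continuous_on_subset[OF cont]) auto
  ultimately obtain u where u: "u \<in> S" "\<And>v. v \<in> S \<Longrightarrow> h u - norm (fst u) \<le> h v - norm (fst v)"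
    using continuous_attains_inf[of S "\<lambda>u. h u - norm (fst u)"] by blast
  define c where "c = h u - norm (fst u)"
  have "snd u \<noteq> 0" using u(1) by (auto simp: S_def)
  hence c: "c > 0" using gt[of "snd u" "fst u"] by (simp add: c_def)
  have "norm a + c * max (norm b - \<eta> * norm a) 0 \<le> h (a, b)" for a b
  proof (cases "norm b \<le> \<eta> * norm a")
    case True
    thus ?thesis using ge[of a b] by simp
  next
    case False
    define r where "r = norm b"
    have "0 \<le> \<eta> * norm a" using \<eta> by simp
    hence r: "r > 0" "\<eta> * norm a < r" using False by (auto simp: r_def)
    have "((1 / r) *\<^sub>R a, (1 / r) *\<^sub>R b) \<in> S"
      using r \<eta> by (auto simp: S_def r_def[symmetric] field_simps)
    from u(2)[OF this] have "c \<le> h ((1 / r) *\<^sub>R a, (1 / r) *\<^sub>R b) - norm ((1 / r) *\<^sub>R a)"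
      by (simp add: c_def)
    also have "\<dots> = (h (a, b) - norm a) / r" using r hom[of "1 / r" a b] by (simp add: field_simps)
    finally have "c * r \<le> h (a, b) - norm a" using r by (simp add: field_simps)
    moreover have "c * max (norm b - \<eta> * norm a) 0 \<le> c * r"
      using c r \<open>0 \<le> \<eta> * norm a\<close> by (intro mult_left_mono) (auto simp: r_def)
    ultimately show ?thesis by simp
  qed
  thus ?thesis using c by blast
qed

text \<open>The graph lies strictly above its tangent at 1: by the mean value theorem the slope is
  larger than \<open>p\<close> to the right of 1 and smaller to the left.\<close>

lemma bernoulli_powr_strict:
  fixes t p :: real
  assumes "t \<ge> 0" "t \<noteq> 1" "p > 1"
  shows "t powr p > 1 + p * (t - 1)"
proof -
  have D: "((\<lambda>x. x powr p) has_real_derivative p * x powr (p - 1)) (at x)" if "x > 0" for x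
    using that by (auto intro!: derivative_eq_intros)
  consider "t > 1" | "t = 0" | "0 < t" "t < 1" using assms by linarith
  thus ?thesis
  proof cases
    case 1
    obtain z where z: "1 < z" "z < t" "t powr p - 1 powr p = (t - 1) * (p * z powr (p - 1))"
      using MVT2[of 1 t "\<lambda>x. x powr p" "\<lambda>x. p * x powr (p - 1)"] D 1 by force
    have "1 < z powr (p - 1)" using z(1) assms(3) powr_less_mono2[of "p - 1" 1 z] by simp
    hence "(t - 1) * (p * 1) < (t - 1) * (p * z powr (p - 1))"
      using 1 assms(3) by (intro mult_strict_left_mono) auto
    thus ?thesis using z by (simp add: algebra_simps)
  next
    case 2
    thus ?thesis using assms by simp
  next
    case 3
    obtain z where z: "t < z" "z < 1" "1 powr p - t powr p = (1 - t) * (p * z powr (p - 1))"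
      using MVT2[of t 1 "\<lambda>x. x powr p" "\<lambda>x. p * x powr (p - 1)"] D 3 by force
    have "z powr (p - 1) < 1" using z 3 assms(3) powr_less_mono2[of "p - 1" z 1] by simp
    hence "(1 - t) * (p * z powr (p - 1)) < (1 - t) * (p * 1)"
      using 3 assms(3) by (intro mult_strict_left_mono) auto
    thus ?thesis using z by (simp add: algebra_simps)
  qed
qed

text \<open>The mean \<open>m\<close> of \<open>\<bar>A + B\<bar>\<close> and
  \<open>\<bar>A - B\<bar>\<close> is at least \<open>\<bar>A\<bar>\<close>. If the two differ,
  adding the tangent inequalities at \<open>a / m\<close> and \<open>b / m\<close> gives strictness;
  if they agree, then \<open>A = 0\<close>.\<close>

lemma abs_powr_midpoint_strict:
  fixes A B p :: real
  assumes "p > 1" "B \<noteq> 0"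
  shows "\<bar>A\<bar> powr p < (\<bar>A + B\<bar> powr p + \<bar>A - B\<bar> powr p) / 2"
proof -
  define a b m where "a = \<bar>A + B\<bar>" and "b = \<bar>A - B\<bar>" and "m = (a + b) / 2"
  have m: "m > 0" "\<bar>A\<bar> \<le> m" using assms by (auto simp: m_def a_def b_def)
  have ab: "a \<ge> 0" "b \<ge> 0" by (auto simp: a_def b_def)
  show ?thesis
  proof (cases "a = b")
    case True
    hence "A = 0" using assms(2) by (auto simp: a_def b_def abs_if split: if_splits)
    thus ?thesis using assms by simp
  next
    case False
    hence "a / m \<noteq> 1" "b / m \<noteq> 1" using m by (auto simp: m_def)
    hence "(a / m) powr p > 1 + p * (a / m - 1)" "(b / m) powr p > 1 + p * (b / m - 1)"
      using bernoulli_powr_strict ab m assms by auto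
    hence "(a / m) powr p + (b / m) powr p > 2 + p * ((a + b) / m - 2)"
      by (simp add: algebra_simps add_divide_distrib)
    also have "(a + b) / m = 2" using m by (simp add: m_def field_simps)
    finally have "(a powr p + b powr p) / m powr p > 2"
      using ab m by (simp add: powr_divide add_divide_distrib)
    hence "m powr p < (a powr p + b powr p) / 2" using m by (simp add: field_simps)
    moreover have "\<bar>A\<bar> powr p \<le> m powr p" using m assms by (intro powr_mono2) auto
    ultimately show ?thesis by (simp add: a_def b_def)
  qed
qed

section \<open>Signed powers and the scalar addition of the convexification\<close>

lemma spow_minus [simp]: "spow s (- t) = - spow s t"
  by (simp add: spow_def sgn_minus)

lemma spow_0 [simp]: "spow s 0 = 0"
  by (simp add: spow_def)

lemma spow_eq_0_iff [simp]: "spow s t = 0 \<longleftrightarrow> t = 0"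
  by (simp add: spow_def sgn_zero_iff)

lemma abs_spow: "\<bar>spow s t\<bar> = \<bar>t\<bar> powr s"
  by (simp add: spow_def abs_mult sgn_if)

lemma spow_nonneg: "0 \<le> t \<Longrightarrow> spow s t = t powr s"
  by (auto simp: spow_def sgn_if)

lemma spow_mult: "0 \<le> c \<Longrightarrow> spow s (c * t) = c powr s * spow s t"
  by (cases "c = 0") (simp_all add: spow_def abs_mult powr_mult sgn_mult)

lemma spow_inverse: "p > 0 \<Longrightarrow> spow p (spow (1 / p) t) = t" "p > 0 \<Longrightarrow> spow (1 / p) (spow p t) = t"
  by (auto simp: spow_def abs_mult powr_powr sgn_mult sgn_if)

text \<open>A difference of powers of the positive and negative parts avoids the discontinuous sign
  function.\<close>

lemma continuous_on_spow [continuous_intros]: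
  assumes "s > 0" "continuous_on A f"
  shows "continuous_on A (\<lambda>x. spow s (f x))"
proof -
  have "spow s t = max t 0 powr s - max (- t) 0 powr s" for t
    by (auto simp: spow_def sgn_if max_def)
  moreover have "continuous_on A (\<lambda>x. max (f x) 0 powr s - max (- f x) 0 powr s)"
    using assms by (intro continuous_intros continuous_on_powr') auto
  ultimately show ?thesis by simp
qed

definition p_sum :: "real \<Rightarrow> real \<times> real \<Rightarrow> real" where
  "p_sum p = (\<lambda>(s, t). spow p (spow (1 / p) s + spow (1 / p) t))"

lemma p_sum_H2:
  assumes "p > 1"
  shows "p_sum p \<in> H2"
  unfolding H2_def
proof (intro CollectI conjI allI impI)
  show "continuous_on UNIV (p_sum p)"
    using assms unfolding p_sum_def case_prod_beta by (intro continuous_intros) auto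
  fix r a b :: real assume r: "0 \<le> r"
  have "(r powr (1 / p)) powr p = r" using r assms by (simp add: powr_powr)
  thus "p_sum p (r * a, r * b) = r * p_sum p (a, b)"
    unfolding p_sum_def prod.case spow_mult[OF r] distrib_left[symmetric]
    by (simp only: spow_mult[OF powr_ge_zero])
qed

text \<open>With \<open>A\<close> and \<open>B\<close> the signed \<open>1 / p\<close>-th powers of
  \<open>s\<close> and \<open>t\<close>, the right side is the mean of
  \<open>\<bar>A + B\<bar> powr p\<close> and \<open>\<bar>A - B\<bar> powr p\<close>, while
  \<open>\<bar>s\<bar> = \<bar>A\<bar> powr p\<close>. Strict midpoint convexity is the gap required
  by \<open>homogeneous_gain\<close>.\<close>

lemma p_sum_gain:
  assumes p: "p > 1" and \<eta>: "\<eta> > 0"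
  shows "\<exists>c>0. \<forall>s t. \<bar>s\<bar> + c * max (\<bar>t\<bar> - \<eta> * \<bar>s\<bar>) 0 \<le> (\<bar>p_sum p (s, t)\<bar> + \<bar>p_sum p (s, - t)\<bar>) / 2"
proof -
  define h where "h u = (\<bar>p_sum p u\<bar> + \<bar>p_sum p (fst u, - snd u)\<bar>) / 2" for u
  have "\<exists>c>0. \<forall>a b. norm a + c * max (norm b - \<eta> * norm a) 0 \<le> h (a, b)"
  proof (rule homogeneous_gain[OF _ _ _ _ \<eta>])
    have cont: "continuous_on UNIV (p_sum p)" using p_sum_H2[OF p] by (simp add: H2_def)
    have "continuous_on UNIV (\<lambda>u. p_sum p (fst u, - snd u))"
      by (rule continuous_on_compose2[OF cont]) (auto intro!: continuous_intros)
    with cont show "continuous_on UNIV h" unfolding h_def by (intro continuous_intros) auto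
    fix r a b :: real assume "r > 0"
    moreover have "p_sum p (r * a, r * c) = r * p_sum p (a, c)" for c
      using p_sum_H2[OF p] \<open>r > 0\<close> by (simp add: H2_def)
    from this[of b] this[of "- b"]
    show "h (r *\<^sub>R a, r *\<^sub>R b) = r * h (a, b)"
      using \<open>r > 0\<close> by (simp add: h_def abs_mult distrib_left)
  next
    fix a b :: real
    have a: "\<bar>spow (1 / p) a\<bar> powr p = \<bar>a\<bar>" using p by (simp add: abs_spow powr_powr)
    show gt: "norm a < h (a, b)" if "b \<noteq> 0"
      using abs_powr_midpoint_strict[OF p, of "spow (1 / p) b" "spow (1 / p) a"] that a
      by (simp add: h_def p_sum_def abs_spow)
    show "norm a \<le> h (a, b)"
      using gt a by (cases "b = 0") (auto simp: h_def p_sum_def abs_spow)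
  qed
  thus ?thesis by (simp add: h_def)
qed

text \<open>This is \<open>y'\<close> with \<open>|x| \<oplus> y' = |x| + |y|\<close>.\<close>

definition p_increment :: "real \<Rightarrow> real \<times> real \<Rightarrow> real" where
  "p_increment p = (\<lambda>(s, t). spow p (spow (1 / p) (\<bar>s\<bar> + \<bar>t\<bar>) - spow (1 / p) \<bar>s\<bar>))"

lemma p_increment_H2:
  assumes "p > 1"
  shows "p_increment p \<in> H2"
  unfolding H2_def
proof (intro CollectI conjI allI impI)
  show "continuous_on UNIV (p_increment p)"
    using assms unfolding p_increment_def case_prod_beta by (intro continuous_intros) auto
  fix r a b :: real assume r: "0 \<le> r"
  have "(r powr (1 / p)) powr p = r" using r assms by (simp add: powr_powr)
  moreover have "\<bar>r * a\<bar> + \<bar>r * b\<bar> = r * (\<bar>a\<bar> + \<bar>b\<bar>)" "\<bar>r * a\<bar> = r * \<bar>a\<bar>"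
    using r by (auto simp: abs_mult distrib_left)
  ultimately show "p_increment p (r * a, r * b) = r * p_increment p (a, b)"
    unfolding p_increment_def prod.case
    by (simp only: spow_mult[OF r] right_diff_distrib[symmetric] spow_mult[OF powr_ge_zero])
qed

text \<open>In \<open>1 / p\<close>-th powers the increment is \<open>R - S\<close> with
  \<open>0 \<le> S \<le> R\<close>. Adding it to \<open>S\<close> gives \<open>R\<close>;
  subtracting it gives \<open>2 * S - R\<close>, whose absolute value is at most
  \<open>R\<close>.\<close>

lemma p_increment_bounds:
  assumes p: "p > 1"
  shows "0 \<le> p_increment p (s, t)" "t \<noteq> 0 \<Longrightarrow> 0 < p_increment p (s, t)"
    and "p_sum p (\<bar>s\<bar>, p_increment p (s, t)) = \<bar>s\<bar> + \<bar>t\<bar>"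
    and "\<bar>p_sum p (\<bar>s\<bar>, - p_increment p (s, t))\<bar> \<le> \<bar>s\<bar> + \<bar>t\<bar>"
proof -
  define R S where "R = (\<bar>s\<bar> + \<bar>t\<bar>) powr (1 / p)" and "S = \<bar>s\<bar> powr (1 / p)"
  have RS: "0 \<le> S" "S \<le> R" using p by (auto simp: R_def S_def intro!: powr_mono2)
  have strict: "S < R" if "t \<noteq> 0" using p that by (auto simp: R_def S_def intro!: powr_less_mono2)
  have Rp: "R powr p = \<bar>s\<bar> + \<bar>t\<bar>" using p by (simp add: R_def powr_powr)
  have inc: "p_increment p (s, t) = spow p (R - S)"
    by (simp add: p_increment_def R_def S_def spow_nonneg)
  show nn: "0 \<le> p_increment p (s, t)" using RS by (simp add: inc spow_nonneg)
  show "0 < p_increment p (s, t)" if "t \<noteq> 0"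
    using strict[OF that] by (simp add: inc spow_nonneg)
  show "p_sum p (\<bar>s\<bar>, p_increment p (s, t)) = \<bar>s\<bar> + \<bar>t\<bar>"
    using p RS Rp by (simp add: p_sum_def inc spow_inverse spow_nonneg[of "\<bar>s\<bar>"] S_def[symmetric] spow_nonneg[of R])
  have "\<bar>p_sum p (\<bar>s\<bar>, - p_increment p (s, t))\<bar> = \<bar>S - (R - S)\<bar> powr p"
    using p by (simp add: p_sum_def inc spow_inverse spow_nonneg[of "\<bar>s\<bar>"] S_def[symmetric] abs_spow)
  also have "\<dots> \<le> R powr p" using RS p by (intro powr_mono2) auto
  finally show "\<bar>p_sum p (\<bar>s\<bar>, - p_increment p (s, t))\<bar> \<le> \<bar>s\<bar> + \<bar>t\<bar>" by (simp add: Rp)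
qed

text \<open>Add \<open>\<bar>s\<bar>\<close> to the increment, apply
  \<open>homogeneous_gain\<close>, and cancel it again.\<close>

lemma p_increment_gain:
  assumes p: "p > 1" and \<eta>: "\<eta> > 0"
  shows "\<exists>c>0. \<forall>s t. c * max (\<bar>t\<bar> - \<eta> * \<bar>s\<bar>) 0 \<le> p_increment p (s, t)"
proof -
  define h where "h u = \<bar>fst u\<bar> + p_increment p u" for u
  have "\<exists>c>0. \<forall>a b. norm a + c * max (norm b - \<eta> * norm a) 0 \<le> h (a, b)"
  proof (rule homogeneous_gain[OF _ _ _ _ \<eta>])
    have "continuous_on UNIV (p_increment p)" using p_increment_H2[OF p] by (simp add: H2_def)
    thus "continuous_on UNIV h" unfolding h_def by (intro continuous_intros) auto
    fix r a b :: real assume "r > 0"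
    thus "h (r *\<^sub>R a, r *\<^sub>R b) = r * h (a, b)"
      using p_increment_H2[OF p] by (simp add: h_def H2_def abs_mult distrib_left)
  qed (use p_increment_bounds[OF p] in \<open>auto simp: h_def\<close>)
  thus ?thesis by (simp add: h_def)
qed

text \<open>The pair \<open>b\<close>, \<open>- b\<close> alone gives no strict gain when
  \<open>b\<close> is a small real multiple of \<open>a\<close>. Equality for both opposite pairs
  would make \<open>b\<close> and \<open>\<i> * b\<close> real multiples of a nonzero
  \<open>a\<close>, which forces \<open>b = 0\<close>.\<close>

lemma four_rotations_gain:
  assumes \<eta>: "\<eta> > 0"
  shows "\<exists>c>0. \<forall>a b. norm a + c * max (norm b - \<eta> * norm a) 0 \<le>
    (norm (a + b) + norm (a + \<i> * b) + norm (a - b) + norm (a - \<i> * b)) / 4"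
proof -
  define h where "h u = (norm (fst u + snd u) + norm (fst u + \<i> * snd u) + norm (fst u - snd u)
    + norm (fst u - \<i> * snd u)) / 4" for u
  have "\<exists>c>0. \<forall>a b. norm a + c * max (norm b - \<eta> * norm a) 0 \<le> h (a, b)"
  proof (rule homogeneous_gain[OF _ _ _ _ \<eta>])
    show "continuous_on UNIV h" unfolding h_def by (intro continuous_intros) auto
  next
    fix r :: real and a b :: complex assume r: "r > 0"
    have "norm (r *\<^sub>R a + r *\<^sub>R c) = r * norm (a + c)" "norm (r *\<^sub>R a - r *\<^sub>R c) = r * norm (a - c)" for c
      using r by (simp_all add: scaleR_add_right[symmetric] scaleR_diff_right[symmetric])
    from this[of b] this[of "\<i> * b"] show "h (r *\<^sub>R a, r *\<^sub>R b) = r * h (a, b)"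
      by (simp add: h_def distrib_left)
  next
    fix a b :: complex
    have tri: "2 * norm a \<le> norm (a + c) + norm (a - c)" for c
      using norm_triangle_ineq[of "a + c" "a - c"] by (simp add: norm_mult flip: mult_2)
    show ge: "norm a \<le> h (a, b)" using tri[of b] tri[of "\<i> * b"] by (simp add: h_def)
    assume b: "b \<noteq> 0"
    show "norm a < h (a, b)"
    proof (rule ccontr)
      assume "\<not> norm a < h (a, b)"
      hence eq: "norm (a + c) + norm (a - c) = 2 * norm a" if "c = b \<or> c = \<i> * b" for c
        using that tri[of b] tri[of "\<i> * b"] by (auto simp: h_def)
      \<comment> \<open>Equality in the triangle inequality for \<open>a + c\<close> and
        \<open>a - c\<close> makes these two vectors parallel, and so \<open>c\<close> parallel to
        \<open>a\<close>.\<close>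
      have parallel: "a * of_real (norm (a + c) - norm (a - c)) = of_real (2 * norm a) * c"
        if "c = b \<or> c = \<i> * b" for c
      proof -
        have "norm ((a + c) + (a - c)) = norm (a + c) + norm (a - c)"
          using eq[OF that] by (simp add: norm_mult flip: mult_2)
        hence "norm (a + c) *\<^sub>R (a - c) = norm (a - c) *\<^sub>R (a + c)" by (simp only: norm_triangle_eq)
        hence "a * of_real (norm (a + c) - norm (a - c)) = of_real (norm (a + c) + norm (a - c)) * c"
          by (simp add: scaleR_conv_of_real algebra_simps)
        thus ?thesis by (simp only: eq[OF that])
      qed
      show False
      proof (cases "a = 0")
        case True
        thus False using eq[of b] b by simp
      next
        case False
        \<comment> \<open>Comparing \<open>c = b\<close> with \<open>c = \<i> * b\<close> makes a
          real number equal to \<open>\<i>\<close> times a real number, so both are zero.\<close>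
        have "a * of_real (norm (a + \<i> * b) - norm (a - \<i> * b)) = a * (\<i> * of_real (norm (a + b) - norm (a - b)))"
          using parallel[of b] parallel[of "\<i> * b"] by (simp add: algebra_simps)
        hence "complex_of_real (norm (a + \<i> * b) - norm (a - \<i> * b)) = \<i> * of_real (norm (a + b) - norm (a - b))"
          using False by (simp only: mult_cancel_left) simp
        hence "norm (a + b) - norm (a - b) = 0" by (auto simp: complex_eq_iff)
        hence "of_real (2 * norm a) * b = 0" using parallel[of b] by simp
        thus False using False b by simp
      qed
    qed
  qed
  thus ?thesis by (simp add: h_def)
qed

lemma powr_sum_H2:
  fixes q :: real
  assumes q: "1 \<le> q"
  shows "(\<lambda>(s, t). (\<bar>s\<bar> powr q + \<bar>t\<bar> powr q) powr (1 / q)) \<in> H2"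
  unfolding H2_def
proof (intro CollectI conjI allI impI)
  show "continuous_on UNIV (\<lambda>(s, t). (\<bar>s\<bar> powr q + \<bar>t\<bar> powr q) powr (1 / q))"
    using q unfolding case_prod_beta
    by (intro continuous_on_powr' continuous_intros) auto
  fix r a b :: real assume r: "0 \<le> r"
  have "\<bar>r * a\<bar> powr q + \<bar>r * b\<bar> powr q = r powr q * (\<bar>a\<bar> powr q + \<bar>b\<bar> powr q)"
    using r by (simp add: abs_mult powr_mult distrib_left)
  moreover have "(r powr q) powr (1 / q) = r" using r q by (simp add: powr_powr)
  ultimately show "(case (r * a, r * b) of (s, t) \<Rightarrow> (\<bar>s\<bar> powr q + \<bar>t\<bar> powr q) powr (1 / q)) =
      r * (case (a, b) of (s, t) \<Rightarrow> (\<bar>s\<bar> powr q + \<bar>t\<bar> powr q) powr (1 / q))"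
    by (simp add: powr_mult)
qed

text \<open>For \<open>v \<le> r = s + t\<close> one has
  \<open>v powr q \<le> v * r powr (q - 1)\<close>; summing over \<open>s\<close> and
  \<open>t\<close> gives \<open>r powr q\<close>. Thus monotonicity with any exponent
  \<open>q\<close> implies the case \<open>q = 1\<close>.\<close>

lemma powr_sum_le_sum:
  fixes s t q :: real
  assumes q: "1 \<le> q" and s: "0 \<le> s" and t: "0 \<le> t"
  shows "(s powr q + t powr q) powr (1 / q) \<le> s + t"
proof (cases "s + t = 0")
  case True
  hence "s = 0" "t = 0" using s t by auto
  thus ?thesis by simp
next
  case False
  define r where "r = s + t"
  have r: "r > 0" using False s t by (simp add: r_def)
  have le: "v powr q \<le> v * r powr (q - 1)" if "0 \<le> v" "v \<le> r" for v
  proof -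
    have "v powr q = v * v powr (q - 1)"
      using that q by (cases "v = 0") (auto simp: powr_diff)
    also have "\<dots> \<le> v * r powr (q - 1)" using that q by (intro mult_left_mono powr_mono2) auto
    finally show ?thesis .
  qed
  have "s powr q + t powr q \<le> r * r powr (q - 1)"
    using le[of s] le[of t] s t by (simp add: r_def distrib_right)
  also have "\<dots> = r powr q" using r by (simp add: powr_diff)
  finally have "(s powr q + t powr q) powr (1 / q) \<le> (r powr q) powr (1 / q)"
    using q by (intro powr_mono2) auto
  also have "\<dots> = r" using r q by (simp add: powr_powr)
  finally show ?thesis by (simp add: r_def)
qed

lemma modulus_H2: "(\<lambda>(s, t). sqrt (s\<^sup>2 + t\<^sup>2)) \<in> H2"
  unfolding H2_def
proof (intro CollectI conjI allI impI)
  show "continuous_on UNIV (\<lambda>(s, t). sqrt (s\<^sup>2 + t\<^sup>2))"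
    unfolding case_prod_beta by (intro continuous_intros)
  fix r a b :: real assume r: "0 \<le> r"
  have "sqrt ((r * a)\<^sup>2 + (r * b)\<^sup>2) = sqrt (r\<^sup>2 * (a\<^sup>2 + b\<^sup>2))" by (simp add: power_mult_distrib distrib_left)
  thus "(case (r * a, r * b) of (s, t) \<Rightarrow> sqrt (s\<^sup>2 + t\<^sup>2)) = r * (case (a, b) of (s, t) \<Rightarrow> sqrt (s\<^sup>2 + t\<^sup>2))"
    using r by (simp add: real_sqrt_mult)
qed

text \<open>The four quarters of the interval are shifted to the first one, where the four-angle
  average appears under a single integral.\<close>

lemma integral_rotation_average:
  fixes G :: "real \<Rightarrow> real"
  assumes cont: "continuous_on UNIV G"
    and ge: "\<And>\<theta>. m \<le> (G \<theta> + G (\<theta> + pi / 2) + G (\<theta> + pi) + G (\<theta> + 3 * pi / 2)) / 4"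
  shows "2 * pi * m \<le> integral {0..2 * pi} G"
proof -
  have int: "G integrable_on {a..b}" for a b
    by (intro integrable_continuous_interval continuous_on_subset[OF cont]) auto
  have int': "(\<lambda>\<theta>. G (\<theta> + c)) integrable_on {a..b}" for a b c
    by (intro integrable_continuous_interval continuous_on_compose2[OF cont]) (auto intro!: continuous_intros)
  have shift: "integral {0..pi / 2} (\<lambda>\<theta>. G (\<theta> + c)) = integral {c..pi / 2 + c} G" for c
    using integral_shift[of 0 c "pi / 2" G] continuous_on_subset[OF cont] by (simp add: o_def)
  have "integral {0..2 * pi} G = integral {0..pi / 2} G + integral {pi / 2..pi} G
      + integral {pi..3 * pi / 2} G + integral {3 * pi / 2..2 * pi} G"
    by (simp add: Henstock_Kurzweil_Integration.integral_combine[OF _ _ int])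
  also have "\<dots> = integral {0..pi / 2} G + integral {0..pi / 2} (\<lambda>\<theta>. G (\<theta> + pi / 2))
      + integral {0..pi / 2} (\<lambda>\<theta>. G (\<theta> + pi)) + integral {0..pi / 2} (\<lambda>\<theta>. G (\<theta> + 3 * pi / 2))"
  proof -
    have "pi / 2 + pi / 2 = pi" "pi / 2 + pi = 3 * pi / 2" "pi / 2 + 3 * pi / 2 = 2 * pi" by simp_all
    thus ?thesis by (simp only: shift)
  qed
  also have "\<dots> = integral {0..pi / 2} (\<lambda>\<theta>. G \<theta> + G (\<theta> + pi / 2) + G (\<theta> + pi) + G (\<theta> + 3 * pi / 2))"
    by (simp add: integral_add integrable_add int int')
  also have "\<dots> \<ge> integral {0..pi / 2} (\<lambda>\<theta>. 4 * m)"
  proof (rule integral_le)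
    show "4 * m \<le> G \<theta> + G (\<theta> + pi / 2) + G (\<theta> + pi) + G (\<theta> + 3 * pi / 2)" for \<theta>
      using ge[of \<theta>] by simp
  qed (intro integrable_add int int' integrable_const_ivl)+
  finally show ?thesis by simp
qed

subsection \<open>Upper local uniform monotonicity and convexity\<close>

definition upper_LUM_sum :: "'a::banach_lattice itself \<Rightarrow> bool" where
  "upper_LUM_sum _ \<longleftrightarrow> (\<forall>x::'a. norm x = 1 \<longrightarrow> (\<forall>\<epsilon>>0. \<exists>\<delta>>0. \<forall>y::'a. norm y \<ge> \<epsilon> \<longrightarrow>
     1 + \<delta> \<le> norm (labs x + labs y)))"

text \<open>Truncation costs little: \<open>labs y\<close> is at most the excess plus
  \<open>\<epsilon> / 2\<close> times \<open>labs x\<close>, and the latter part has norm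
  \<open>\<epsilon> / 2\<close>.\<close>

lemma norm_excess_ge:
  fixes x y :: "'a::banach_lattice"
  assumes "norm x = 1" "\<epsilon> > 0" "norm y \<ge> \<epsilon>" "c > 0"
  shows "c * (\<epsilon> / 2) \<le> norm (c *\<^sub>R sup (labs y - (\<epsilon> / 2) *\<^sub>R labs x) 0)"
proof -
  define z where "z = sup (labs y - (\<epsilon> / 2) *\<^sub>R labs x) 0"
  have "labs y - (\<epsilon> / 2) *\<^sub>R labs x \<le> z" by (simp add: z_def)
  hence "labs y \<le> z + (\<epsilon> / 2) *\<^sub>R labs x" by (simp add: diff_le_eq)
  hence "norm y \<le> norm (z + (\<epsilon> / 2) *\<^sub>R labs x)" by (rule norm_le_of_labs_le)
  also have "\<dots> \<le> norm z + \<epsilon> / 2"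
    using norm_triangle_ineq[of z "(\<epsilon> / 2) *\<^sub>R labs x"] assms by simp
  finally show ?thesis using assms by (simp add: z_def)
qed

text \<open>Monotonicity is applied to the scaled excess in place of \<open>y\<close>, with
  threshold \<open>c * (\<epsilon> / 2)\<close>. The result has the shape of the lower bounds coming
  from \<open>homogeneous_gain\<close>.\<close>

lemma upper_LUM_sum_excess:
  fixes x :: "'a::banach_lattice"
  assumes "upper_LUM_sum TYPE('a)" "norm x = 1" "\<epsilon> > 0" "c > 0"
  shows "\<exists>\<delta>>0. \<forall>y. norm y \<ge> \<epsilon> \<longrightarrow>
    1 + \<delta> \<le> norm (labs x + c *\<^sub>R sup (labs y - (\<epsilon> / 2) *\<^sub>R labs x) 0)"
proof -
  have "c * (\<epsilon> / 2) > 0" using assms by simp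
  then obtain \<delta> where \<delta>: "\<delta> > 0" "\<And>y. norm y \<ge> c * (\<epsilon> / 2) \<Longrightarrow> 1 + \<delta> \<le> norm (labs x + labs y)"
    using assms(1,2) unfolding upper_LUM_sum_def by blast
  have "1 + \<delta> \<le> norm (labs x + c *\<^sub>R sup (labs y - (\<epsilon> / 2) *\<^sub>R labs x) 0)" if "norm y \<ge> \<epsilon>" for y
  proof -
    have "labs (c *\<^sub>R sup (labs y - (\<epsilon> / 2) *\<^sub>R labs x) 0) = c *\<^sub>R sup (labs y - (\<epsilon> / 2) *\<^sub>R labs x) 0"
      using assms by (intro labs_of_nonneg scaleR_nonneg_nonneg) auto
    thus ?thesis using \<delta>(2)[OF norm_excess_ge[OF assms(2,3) that assms(4)]] by simp
  qed
  thus ?thesis using \<delta>(1) by blast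
qed

lemma sum_labs_ideal:
  fixes x y :: "'a::banach_lattice"
  shows "x \<in> principal_ideal (labs x + labs y)" "y \<in> principal_ideal (labs x + labs y)"
  by (simp_all add: principal_ideal_le)

lemma labs_krivine2_le:
  fixes x y :: "'a::banach_lattice"
  assumes f: "f \<in> H2" and le: "\<And>s t. \<bar>f (s, t)\<bar> \<le> \<bar>s\<bar> + \<bar>t\<bar>"
  shows "labs (krivine2 x y f) \<le> labs x + labs y"
proof -
  define u where "u = labs x + labs y"
  have u: "0 \<le> u" by (simp add: u_def)
  have xy: "x \<in> principal_ideal u" "y \<in> principal_ideal u" by (simp_all add: u_def sum_labs_ideal)
  note I = principal_ideal_intros[where u = u] xy krivine2_ideal[OF u xy f]
  show ?thesis
  proof (rule le_by_lattice_hom[OF u])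
    fix \<phi> assume \<phi>: "lattice_hom_on (principal_ideal u) \<phi>"
    show "\<phi> (labs (krivine2 x y f)) \<le> \<phi> (labs x + labs y)"
      using le by (simp add: lattice_hom_onD[OF \<phi>] I lattice_hom_krivine2[OF u xy f \<phi>])
  qed (intro I)+
qed

lemma krivine2_abs_sum:
  fixes x y :: "'a::banach_lattice"
  assumes f: "f \<in> H2" and eq: "\<And>s t. f (s, t) = \<bar>s\<bar> + \<bar>t\<bar>"
  shows "krivine2 x y f = labs x + labs y"
proof -
  define u where "u = labs x + labs y"
  have u: "0 \<le> u" by (simp add: u_def)
  have xy: "x \<in> principal_ideal u" "y \<in> principal_ideal u" by (simp_all add: u_def sum_labs_ideal)
  note I = principal_ideal_intros[where u = u] xy krivine2_ideal[OF u xy f]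
  show ?thesis
  proof (rule eq_by_lattice_hom[OF u])
    fix \<phi> assume \<phi>: "lattice_hom_on (principal_ideal u) \<phi>"
    show "\<phi> (krivine2 x y f) = \<phi> (labs x + labs y)"
      by (simp add: lattice_hom_onD[OF \<phi>] I lattice_hom_krivine2[OF u xy f \<phi>] eq)
  qed (intro I)+
qed

text \<open>The \<open>q\<close>-sum is dominated by \<open>labs x + labs y\<close>, which handles
  one direction; for the other, \<open>q = 1\<close> is the exponent chosen.\<close>

lemma upper_LUM_iff_sum: "upper_LUM TYPE('a::banach_lattice) \<longleftrightarrow> upper_LUM_sum TYPE('a)"
proof
  assume "upper_LUM TYPE('a)"
  then obtain q :: real where q: "1 \<le> q" and *: "\<And>x::'a. norm x = 1 \<Longrightarrow> (\<forall>\<epsilon>>0. \<exists>\<delta>>0. \<forall>y::'a. norm y \<ge> \<epsilon> \<longrightarrow>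
      norm (krivine2 x y (\<lambda>(s, t). (\<bar>s\<bar> powr q + \<bar>t\<bar> powr q) powr (1 / q))) - 1 \<ge> \<delta>)"
    unfolding upper_LUM_def by blast
  have le: "norm (krivine2 x y (\<lambda>(s, t). (\<bar>s\<bar> powr q + \<bar>t\<bar> powr q) powr (1 / q))) \<le> norm (labs x + labs y)"
    for x y :: 'a
    by (intro norm_le_of_labs_le labs_krivine2_le powr_sum_H2 q) (simp add: powr_sum_le_sum q)
  show "upper_LUM_sum TYPE('a)" unfolding upper_LUM_sum_def
  proof (intro allI impI)
    fix x :: 'a and \<epsilon> :: real assume "norm x = 1" "\<epsilon> > 0"
    then obtain \<delta> where \<delta>: "\<delta> > 0" "\<And>y::'a. norm y \<ge> \<epsilon> \<Longrightarrow>
      norm (krivine2 x y (\<lambda>(s, t). (\<bar>s\<bar> powr q + \<bar>t\<bar> powr q) powr (1 / q))) - 1 \<ge> \<delta>" using * by meson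
    have "1 + \<delta> \<le> norm (labs x + labs y)" if "norm y \<ge> \<epsilon>" for y
      using \<delta>(2)[OF that] le[of x y] by linarith
    thus "\<exists>\<delta>>0. \<forall>y. norm y \<ge> \<epsilon> \<longrightarrow> 1 + \<delta> \<le> norm (labs x + labs y)" using \<delta>(1) by blast
  qed
next
  assume sum: "upper_LUM_sum TYPE('a)"
  have eq: "krivine2 x y (\<lambda>(s, t). (\<bar>s\<bar> powr 1 + \<bar>t\<bar> powr 1) powr (1 / 1)) = labs x + labs y" for x y :: 'a
    by (intro krivine2_abs_sum powr_sum_H2) auto
  show "upper_LUM TYPE('a)" unfolding upper_LUM_def
  proof (rule exI[of _ 1], intro conjI allI impI)
    fix x :: 'a and \<epsilon> :: real assume "norm x = 1" "\<epsilon> > 0"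
    then obtain \<delta> where \<delta>: "\<delta> > 0" "\<And>y::'a. norm y \<ge> \<epsilon> \<Longrightarrow> 1 + \<delta> \<le> norm (labs x + labs y)"
      using sum unfolding upper_LUM_sum_def by meson
    have "\<delta> \<le> norm (krivine2 x y (\<lambda>(s, t). (\<bar>s\<bar> powr 1 + \<bar>t\<bar> powr 1) powr (1 / 1))) - 1"
      if "norm y \<ge> \<epsilon>" for y
      unfolding eq using \<delta>(2)[OF that] by linarith
    thus "\<exists>\<delta>>0. \<forall>y. norm y \<ge> \<epsilon> \<longrightarrow>
        \<delta> \<le> norm (krivine2 x y (\<lambda>(s, t). (\<bar>s\<bar> powr 1 + \<bar>t\<bar> powr 1) powr (1 / 1))) - 1"
      using \<delta>(1) by blast
  qed simp
qed

section \<open>Midpoint local uniform convexity of the convexification\<close>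

lemma pnorm_powr: "p > 0 \<Longrightarrow> pnorm p x powr p = norm x"
  by (simp add: pnorm_def powr_powr)

lemma pnorm_eq_1_iff: "p > 0 \<Longrightarrow> pnorm p x = 1 \<longleftrightarrow> norm x = 1"
  by (metis pnorm_powr pnorm_def powr_one_eq_one)

lemma pscale_minus_1: "pscale p (- 1) x = - x"
  by (simp add: pscale_def spow_def)

lemma padd_eq: "padd p x y = krivine2 x y (p_sum p)"
  by (simp add: padd_def p_sum_def)

text \<open>By \<open>p_sum_gain\<close> the average of the absolute values of the two midpoint
  candidates dominates \<open>labs x\<close> plus an excess of norm bounded below. The average has
  norm at least \<open>1 + \<delta>\<close>, hence so does one of the candidates.\<close>

lemma upper_LUM_sum_imp_MLUC:
  assumes sum: "upper_LUM_sum TYPE('a::banach_lattice)" and p: "p > 1"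
  shows "convexification_MLUC TYPE('a) p"
  unfolding convexification_MLUC_def
proof (intro allI impI)
  fix x :: 'a and \<epsilon> :: real assume "pnorm p x = 1" and \<epsilon>: "\<epsilon> > 0"
  hence x: "norm x = 1" using pnorm_eq_1_iff[of p x] p by simp
  \<comment> \<open>The threshold for \<open>pnorm\<close> expressed in the norm of the lattice;
    \<open>d\<close> below makes the reverse conversion for the gain.\<close>
  define e where "e = \<epsilon> powr p"
  have e: "e > 0" using \<epsilon> by (simp add: e_def)
  obtain c where c: "c > 0" "\<And>s t. \<bar>s\<bar> + c * max (\<bar>t\<bar> - (e / 2) * \<bar>s\<bar>) 0 \<le>
      (\<bar>p_sum p (s, t)\<bar> + \<bar>p_sum p (s, - t)\<bar>) / 2"
    using p_sum_gain[OF p, of "e / 2"] e by auto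
  obtain \<delta> where \<delta>: "\<delta> > 0" "\<And>y. norm y \<ge> e \<Longrightarrow>
      1 + \<delta> \<le> norm (labs x + c *\<^sub>R sup (labs y - (e / 2) *\<^sub>R labs x) 0)"
    using upper_LUM_sum_excess[OF sum x e c(1)] by blast
  have main: "1 + \<delta> \<le> max (norm (padd p x y)) (norm (padd p x (- y)))" if y: "norm y \<ge> e" for y
  proof -
    define u where "u = labs x + labs y"
    have u: "0 \<le> u" by (simp add: u_def)
    have xy: "x \<in> principal_ideal u" "y \<in> principal_ideal u" by (simp_all add: u_def sum_labs_ideal)
    note H = p_sum_H2[OF p]
    note ny = principal_ideal_minus[OF xy(2)]
    note I = principal_ideal_intros[where u = u] xy krivine2_ideal[OF u xy H] krivine2_ideal[OF u xy(1) ny H]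
    have "labs x + c *\<^sub>R sup (labs y - (e / 2) *\<^sub>R labs x) 0 \<le>
        (1 / 2) *\<^sub>R (labs (padd p x y) + labs (padd p x (- y)))" (is "?l \<le> ?r")
      unfolding padd_eq
    proof (rule le_by_lattice_hom[OF u])
      fix \<phi> assume \<phi>: "lattice_hom_on (principal_ideal u) \<phi>"
      show "\<phi> (labs x + c *\<^sub>R sup (labs y - (e / 2) *\<^sub>R labs x) 0) \<le>
        \<phi> ((1 / 2) *\<^sub>R (labs (krivine2 x y (p_sum p)) + labs (krivine2 x (- y) (p_sum p))))"
        using c(2)[of "\<phi> x" "\<phi> y"]
        by (simp add: lattice_hom_onD[OF \<phi>] lattice_hom_on_0[OF \<phi>] I lattice_hom_krivine2[OF u xy H \<phi>]
            lattice_hom_krivine2[OF u xy(1) ny H \<phi>])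
    qed (intro I)+
    moreover have "0 \<le> ?l" using c(1) by (intro add_nonneg_nonneg scaleR_nonneg_nonneg) auto
    ultimately have "norm ?l \<le> norm ?r" by (intro norm_le_of_nonneg_le)
    also have "\<dots> \<le> (norm (padd p x y) + norm (padd p x (- y))) / 2"
      using norm_triangle_ineq[of "labs (padd p x y)" "labs (padd p x (- y))"] by simp
    finally show ?thesis using \<delta>(2)[OF y] by (simp add: max_def)
  qed
  define d where "d = (1 + \<delta>) powr (1 / p) - 1"
  have "1 powr (1 / p) < (1 + \<delta>) powr (1 / p)" using p \<delta>(1) by (intro powr_less_mono2) auto
  hence d: "d > 0" by (simp add: d_def)
  have "1 + d \<le> max (pnorm p (padd p x y)) (pnorm p (padd p x (pscale p (- 1) y)))"
    if y: "pnorm p y \<ge> \<epsilon>" for y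
  proof -
    have "e \<le> pnorm p y powr p" unfolding e_def using y \<epsilon> p by (intro powr_mono2) auto
    hence "norm y \<ge> e" using pnorm_powr p by (metis less_trans zero_less_one)
    from main[OF this] consider "1 + \<delta> \<le> norm (padd p x y)" | "1 + \<delta> \<le> norm (padd p x (- y))"
      by (auto simp: le_max_iff_disj)
    thus ?thesis unfolding pscale_minus_1
    proof cases
      case 1
      hence "1 + d \<le> pnorm p (padd p x y)" unfolding d_def pnorm_def using p \<delta>(1) by (simp add: powr_mono2)
      thus "1 + d \<le> max (pnorm p (padd p x y)) (pnorm p (padd p x (- y)))" by simp
    next
      case 2
      hence "1 + d \<le> pnorm p (padd p x (- y))" unfolding d_def pnorm_def using p \<delta>(1) by (simp add: powr_mono2)
      thus "1 + d \<le> max (pnorm p (padd p x y)) (pnorm p (padd p x (- y)))" by simp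
    qed
  qed
  thus "\<exists>\<delta>>0. \<forall>y. pnorm p y \<ge> \<epsilon> \<longrightarrow>
      1 + \<delta> \<le> max (pnorm p (padd p x y)) (pnorm p (padd p x (pscale p (- 1) y)))"
    using d by blast
qed

text \<open>Convexity is tested at \<open>labs x\<close> in the direction \<open>z\<close> given by
  \<open>p_increment\<close>. Both perturbed points are bounded by \<open>labs x + labs y\<close>,
  and \<open>z\<close> dominates the excess of \<open>y\<close>, so it cannot be small.\<close>

lemma MLUC_imp_upper_LUM_sum:
  assumes mluc: "convexification_MLUC TYPE('a::banach_lattice) p" and p: "p > 1"
  shows "upper_LUM_sum TYPE('a)"
  unfolding upper_LUM_sum_def
proof (intro allI impI)
  fix x :: 'a and \<epsilon> :: real assume x: "norm x = 1" and \<epsilon>: "\<epsilon> > 0"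
  obtain c where c: "c > 0" "\<And>s t. c * max (\<bar>t\<bar> - (\<epsilon> / 2) * \<bar>s\<bar>) 0 \<le> p_increment p (s, t)"
    using p_increment_gain[OF p, of "\<epsilon> / 2"] \<epsilon> by auto
  \<comment> \<open>\<open>c * (\<epsilon> / 2)\<close> will bound \<open>norm z\<close> from below;
    the exponent converts this into a bound for \<open>pnorm\<close>.\<close>
  define e where "e = (c * (\<epsilon> / 2)) powr (1 / p)"
  have e: "e > 0" using c(1) \<epsilon> by (simp add: e_def)
  have "pnorm p (labs x) = 1" using x by (simp add: pnorm_def)
  then obtain \<delta> where \<delta>: "\<delta> > 0" "\<And>z. pnorm p z \<ge> e \<Longrightarrow>
      1 + \<delta> \<le> max (pnorm p (padd p (labs x) z)) (pnorm p (padd p (labs x) (- z)))"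
    using mluc e unfolding convexification_MLUC_def pscale_minus_1 by meson
  have "1 + \<delta> \<le> norm (labs x + labs y)" if y: "norm y \<ge> \<epsilon>" for y
  proof -
    define u where "u = labs x + labs y"
    define z where "z = krivine2 x y (p_increment p)"
    have u: "0 \<le> u" by (simp add: u_def)
    have xy: "x \<in> principal_ideal u" "y \<in> principal_ideal u" by (simp_all add: u_def sum_labs_ideal)
    note H = p_sum_H2[OF p]
    have z: "z \<in> principal_ideal u" unfolding z_def by (rule krivine2_ideal[OF u xy p_increment_H2[OF p]])
    note lx = principal_ideal_labs[OF xy(1)] and nz = principal_ideal_minus[OF z]
    note I = principal_ideal_intros[where u = u] xy z krivine2_ideal[OF u lx z H] krivine2_ideal[OF u lx nz H]
    have \<phi>z: "\<phi> z = p_increment p (\<phi> x, \<phi> y)" if "lattice_hom_on (principal_ideal u) \<phi>" for \<phi>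
      unfolding z_def by (rule lattice_hom_krivine2[OF u xy p_increment_H2[OF p] that])
    have \<phi>u: "\<phi> u = \<bar>\<phi> x\<bar> + \<bar>\<phi> y\<bar>" if \<phi>: "lattice_hom_on (principal_ideal u) \<phi>" for \<phi>
    proof -
      have "\<phi> u = \<phi> (labs x + labs y)" by (simp only: u_def)
      thus ?thesis by (simp add: lattice_hom_onD[OF \<phi>] I)
    qed
    have "c *\<^sub>R sup (labs y - (\<epsilon> / 2) *\<^sub>R labs x) 0 \<le> z"
    proof (rule le_by_lattice_hom[OF u])
      fix \<phi> assume \<phi>: "lattice_hom_on (principal_ideal u) \<phi>"
      show "\<phi> (c *\<^sub>R sup (labs y - (\<epsilon> / 2) *\<^sub>R labs x) 0) \<le> \<phi> z"
        using c(2)[of "\<phi> y" "\<phi> x"] by (simp add: lattice_hom_onD[OF \<phi>] lattice_hom_on_0[OF \<phi>] I \<phi>z[OF \<phi>])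
    qed (intro I)+
    hence "norm (c *\<^sub>R sup (labs y - (\<epsilon> / 2) *\<^sub>R labs x) 0) \<le> norm z"
      using c(1) by (intro norm_le_of_nonneg_le scaleR_nonneg_nonneg) auto
    hence "c * (\<epsilon> / 2) \<le> norm z" using norm_excess_ge[OF x \<epsilon> y c(1)] by linarith
    hence "pnorm p z \<ge> e" unfolding e_def pnorm_def using c(1) \<epsilon> p by (intro powr_mono2) auto
    note \<delta>z = \<delta>(2)[OF this]
    have "labs (padd p (labs x) z) \<le> u" unfolding padd_eq
    proof (rule le_by_lattice_hom[OF u])
      fix \<phi> assume \<phi>: "lattice_hom_on (principal_ideal u) \<phi>"
      show "\<phi> (labs (krivine2 (labs x) z (p_sum p))) \<le> \<phi> u"
        using p_increment_bounds(3)[OF p, of "\<phi> x" "\<phi> y"]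
        by (simp add: lattice_hom_onD[OF \<phi>] I \<phi>z[OF \<phi>] \<phi>u[OF \<phi>] lattice_hom_krivine2[OF u lx z H \<phi>])
    qed (use xy in \<open>auto intro!: I simp: principal_ideal_le labs_of_nonneg u\<close>)
    hence 1: "norm (padd p (labs x) z) \<le> norm u" by (rule norm_le_of_labs_le)
    have "labs (padd p (labs x) (- z)) \<le> u" unfolding padd_eq
    proof (rule le_by_lattice_hom[OF u])
      fix \<phi> assume \<phi>: "lattice_hom_on (principal_ideal u) \<phi>"
      show "\<phi> (labs (krivine2 (labs x) (- z) (p_sum p))) \<le> \<phi> u"
        using p_increment_bounds(4)[OF p, of "\<phi> x" "\<phi> y"]
        by (simp add: lattice_hom_onD[OF \<phi>] I \<phi>z[OF \<phi>] \<phi>u[OF \<phi>] lattice_hom_krivine2[OF u lx nz H \<phi>])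
    qed (use xy in \<open>auto intro!: I simp: principal_ideal_le labs_of_nonneg u\<close>)
    hence 2: "norm (padd p (labs x) (- z)) \<le> norm u" by (rule norm_le_of_labs_le)
    have "1 + \<delta> \<le> norm u powr (1 / p)"
    proof -
      have "pnorm p (padd p (labs x) z) \<le> norm u powr (1 / p)"
        "pnorm p (padd p (labs x) (- z)) \<le> norm u powr (1 / p)"
        unfolding pnorm_def using 1 2 p by (auto intro!: powr_mono2)
      thus ?thesis using \<delta>z by simp
    qed
    \<comment> \<open>Once \<open>norm u \<ge> 1\<close>, dropping the exponent
      \<open>1 / p < 1\<close> can only enlarge the right side, so the same \<open>\<delta>\<close>
      works.\<close>
    moreover from this have "norm u \<ge> 1"
    proof (rule contrapos_pp)
      assume "\<not> norm u \<ge> 1"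
      hence "norm u powr (1 / p) \<le> 1 powr (1 / p)" using p by (intro powr_mono2) auto
      thus "\<not> 1 + \<delta> \<le> norm u powr (1 / p)" using \<delta>(1) by simp
    qed
    hence "norm u powr (1 / p) \<le> norm u powr 1" using p by (intro powr_mono) auto
    hence "norm u powr (1 / p) \<le> norm u" by simp
    ultimately show ?thesis unfolding u_def by linarith
  qed
  thus "\<exists>\<delta>>0. \<forall>y. norm y \<ge> \<epsilon> \<longrightarrow> 1 + \<delta> \<le> norm (labs x + labs y)" using \<delta>(1) by blast
qed

section \<open>Complexification and averages over rotations\<close>

abbreviation modulus :: "'a::banach_lattice \<times> 'a \<Rightarrow> 'a" where
  "modulus z \<equiv> krivine2 (fst z) (snd z) (\<lambda>(s, t). sqrt (s\<^sup>2 + t\<^sup>2))"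

lemma lattice_hom_modulus:
  assumes u: "0 \<le> u" and z: "fst z \<in> principal_ideal u" "snd z \<in> principal_ideal u"
  shows "modulus z \<in> principal_ideal u"
    and "lattice_hom_on (principal_ideal u) \<phi> \<Longrightarrow> \<phi> (modulus z) = cmod (Complex (\<phi> (fst z)) (\<phi> (snd z)))"
  using krivine2_ideal[OF u z modulus_H2] lattice_hom_krivine2[OF u z modulus_H2]
  by (simp_all add: complex_norm)

lemma modulus_nonneg: "0 \<le> modulus (z :: 'a::banach_lattice \<times> 'a)"
proof (rule le_by_lattice_hom)
  show u: "0 \<le> labs (fst z) + labs (snd z)" by simp
  show "modulus z \<in> principal_ideal (labs (fst z) + labs (snd z))"
    by (intro lattice_hom_modulus u sum_labs_ideal)
  fix \<phi> assume \<phi>: "lattice_hom_on (principal_ideal (labs (fst z) + labs (snd z))) \<phi>"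
  show "\<phi> 0 \<le> \<phi> (modulus z)"
    unfolding lattice_hom_on_0[OF \<phi>] lattice_hom_modulus(2)[OF u sum_labs_ideal \<phi>] by simp
qed (rule principal_ideal_0)

text \<open>One dominating \<open>u\<close> puts all rotated sums
  \<open>z + e^(i \<theta>) w\<close> into the same ideal, so their moduli at different angles can
  be compared under a single \<open>\<phi>\<close>.\<close>

locale complex_pair =
  fixes z w :: "'a::banach_lattice \<times> 'a"
begin

definition u :: 'a where "u = labs (fst z) + labs (snd z) + (labs (fst w) + labs (snd w))"

lemma u_nonneg: "0 \<le> u"
  unfolding u_def by (intro add_nonneg_nonneg) auto

lemma ideal: "fst z \<in> principal_ideal u" "snd z \<in> principal_ideal u"
  "fst w \<in> principal_ideal u" "snd w \<in> principal_ideal u"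
proof -
  have le: "a \<le> labs (fst z) + labs (snd z) \<Longrightarrow> a \<le> u" "a \<le> labs (fst w) + labs (snd w) \<Longrightarrow> a \<le> u" for a
    unfolding u_def by (auto intro: add_increasing add_increasing2 add_nonneg_nonneg)
  show "fst z \<in> principal_ideal u" "snd z \<in> principal_ideal u"
    "fst w \<in> principal_ideal u" "snd w \<in> principal_ideal u"
    by (intro principal_ideal_le le(1) labs_le_sum principal_ideal_le le(2))+
qed

abbreviation F :: "real \<Rightarrow> 'a" where "F \<theta> \<equiv> modulus (cadd z (crot \<theta> w))"

lemma rotation_ideal: "fst (cadd z (crot \<theta> w)) \<in> principal_ideal u" "snd (cadd z (crot \<theta> w)) \<in> principal_ideal u"
  unfolding cadd_def crot_def fst_conv snd_conv by (intro principal_ideal_intros ideal)+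

lemma F_ideal: "F \<theta> \<in> principal_ideal u"
  by (intro lattice_hom_modulus(1) u_nonneg rotation_ideal)

lemma modulus_ideal: "modulus z \<in> principal_ideal u" "modulus w \<in> principal_ideal u"
  by (intro lattice_hom_modulus(1) u_nonneg ideal)+

context
  fixes \<phi> a b
  assumes \<phi>: "lattice_hom_on (principal_ideal u) \<phi>"
  defines "a \<equiv> Complex (\<phi> (fst z)) (\<phi> (snd z))" and "b \<equiv> Complex (\<phi> (fst w)) (\<phi> (snd w))"
begin

lemma hom_modulus: "\<phi> (modulus z) = cmod a" "\<phi> (modulus w) = cmod b"
  using lattice_hom_modulus(2)[OF u_nonneg ideal(1,2) \<phi>] lattice_hom_modulus(2)[OF u_nonneg ideal(3,4) \<phi>]
  by (simp_all only: a_def b_def)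

text \<open>Componentwise, \<open>\<phi>\<close> carries pairs to complex numbers and
  \<open>crot \<theta>\<close> to multiplication by \<open>cis \<theta>\<close>. Estimates for
  \<open>F\<close> thereby become estimates in the complex plane.\<close>

lemma hom_F: "\<phi> (F \<theta>) = cmod (a + cis \<theta> * b)"
proof -
  have "Complex (\<phi> (fst (cadd z (crot \<theta> w)))) (\<phi> (snd (cadd z (crot \<theta> w)))) = a + cis \<theta> * b"
    by (simp add: complex_eq_iff a_def b_def cadd_def crot_def lattice_hom_onD[OF \<phi>] ideal
        principal_ideal_intros)
  thus ?thesis using lattice_hom_modulus(2)[OF u_nonneg rotation_ideal \<phi>] by metis
qed

end

lemma F_le: "F \<theta> \<le> modulus z + modulus w"
proof (rule le_by_lattice_hom[OF u_nonneg])
  fix \<phi> assume \<phi>: "lattice_hom_on (principal_ideal u) \<phi>"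
  show "\<phi> (F \<theta>) \<le> \<phi> (modulus z + modulus w)"
    unfolding lattice_hom_onD(1)[OF \<phi> modulus_ideal] hom_F[OF \<phi>] hom_modulus[OF \<phi>]
    by (rule order_trans[OF norm_triangle_ineq]) (simp add: norm_mult)
qed (intro principal_ideal_intros F_ideal modulus_ideal)+

text \<open>The reverse triangle inequality for complex numbers. It makes \<open>F\<close>
  continuous in the angle, so the integrals exist.\<close>

lemma labs_F_diff_le: "labs (F \<theta> - F \<theta>') \<le> cmod (cis \<theta> - cis \<theta>') *\<^sub>R modulus w"
proof (rule le_by_lattice_hom[OF u_nonneg])
  fix \<phi> assume \<phi>: "lattice_hom_on (principal_ideal u) \<phi>"
  let ?a = "Complex (\<phi> (fst z)) (\<phi> (snd z))" and ?b = "Complex (\<phi> (fst w)) (\<phi> (snd w))"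
  have "\<bar>cmod (?a + cis \<theta> * ?b) - cmod (?a + cis \<theta>' * ?b)\<bar> \<le> cmod ((cis \<theta> - cis \<theta>') * ?b)"
    using norm_triangle_ineq3[of "?a + cis \<theta> * ?b" "?a + cis \<theta>' * ?b"] by (simp add: algebra_simps)
  thus "\<phi> (labs (F \<theta> - F \<theta>')) \<le> \<phi> (cmod (cis \<theta> - cis \<theta>') *\<^sub>R modulus w)"
    by (simp add: lattice_hom_onD[OF \<phi>] F_ideal modulus_ideal principal_ideal_diff hom_F[OF \<phi>]
        hom_modulus[OF \<phi>] norm_mult)
qed (intro principal_ideal_intros F_ideal modulus_ideal)+

lemma continuous_norm_F: "continuous_on UNIV (\<lambda>\<theta>. norm (F \<theta>))"
proof -
  have "continuous_on UNIV F" unfolding continuous_on_def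
  proof (intro ballI)
    fix \<theta> :: real
    have "((\<lambda>\<theta>'. cmod (cis \<theta>' - cis \<theta>) * norm (modulus w)) \<longlongrightarrow> cmod (cis \<theta> - cis \<theta>) * norm (modulus w)) (at \<theta>)"
      by (intro tendsto_intros)
    hence lim: "((\<lambda>\<theta>'. cmod (cis \<theta>' - cis \<theta>) * norm (modulus w)) \<longlongrightarrow> 0) (at \<theta>)" by simp
    have "norm (F \<theta>' - F \<theta>) \<le> cmod (cis \<theta>' - cis \<theta>) * norm (modulus w)" for \<theta>'
      using norm_le_of_labs_le[OF labs_F_diff_le, of \<theta>' \<theta>] by simp
    hence "((\<lambda>\<theta>'. F \<theta>' - F \<theta>) \<longlongrightarrow> 0) (at \<theta>)"
      by (intro Lim_null_comparison[OF _ lim]) auto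
    thus "(F \<longlongrightarrow> F \<theta>) (at \<theta> within UNIV)" by (simp add: LIM_zero_iff)
  qed
  thus ?thesis by (intro continuous_intros)
qed

text \<open>The scalar bound is used with \<open>cis \<theta> * b\<close> in place of
  \<open>b\<close>, which has the same modulus; the quarter turns multiply it by
  \<open>\<i>\<close>, \<open>-1\<close> and \<open>- \<i>\<close>.\<close>

lemma F_average_ge:
  assumes "\<And>a b. norm a + c * max (norm b - \<eta> * norm a) 0 \<le>
    (norm (a + b) + norm (a + \<i> * b) + norm (a - b) + norm (a - \<i> * b)) / 4"
  shows "modulus z + c *\<^sub>R sup (modulus w - \<eta> *\<^sub>R modulus z) 0 \<le>
    (1 / 4) *\<^sub>R (F \<theta> + F (\<theta> + pi / 2) + F (\<theta> + pi) + F (\<theta> + 3 * pi / 2))"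
proof (rule le_by_lattice_hom[OF u_nonneg])
  fix \<phi> assume \<phi>: "lattice_hom_on (principal_ideal u) \<phi>"
  let ?a = "Complex (\<phi> (fst z)) (\<phi> (snd z))" and ?b = "Complex (\<phi> (fst w)) (\<phi> (snd w))"
  have rot: "cis (\<theta> + pi / 2) = \<i> * cis \<theta>" "cis (\<theta> + pi) = - cis \<theta>" "cis (\<theta> + 3 * pi / 2) = - (\<i> * cis \<theta>)"
  proof -
    show 1: "cis (\<theta> + pi / 2) = \<i> * cis \<theta>" for \<theta> by (simp add: cis_mult[symmetric])
    show 2: "cis (\<theta> + pi) = - cis \<theta>" for \<theta> by (simp add: cis_mult[symmetric])
    have "\<theta> + 3 * pi / 2 = (\<theta> + pi / 2) + pi" by simp
    thus "cis (\<theta> + 3 * pi / 2) = - (\<i> * cis \<theta>)" using 1[of \<theta>] 2[of "\<theta> + pi / 2"] by metis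
  qed
  have "norm ?a + c * max (norm (cis \<theta> * ?b) - \<eta> * norm ?a) 0 \<le>
    (norm (?a + cis \<theta> * ?b) + norm (?a + \<i> * (cis \<theta> * ?b)) + norm (?a - cis \<theta> * ?b)
      + norm (?a - \<i> * (cis \<theta> * ?b))) / 4" by (rule assms)
  hence "norm ?a + c * max (norm ?b - \<eta> * norm ?a) 0 \<le>
    (norm (?a + cis \<theta> * ?b) + norm (?a + \<i> * cis \<theta> * ?b) + norm (?a - cis \<theta> * ?b)
      + norm (?a - \<i> * cis \<theta> * ?b)) / 4" by (simp add: norm_mult mult.assoc)
  thus "\<phi> (modulus z + c *\<^sub>R sup (modulus w - \<eta> *\<^sub>R modulus z) 0) \<le>
      \<phi> ((1 / 4) *\<^sub>R (F \<theta> + F (\<theta> + pi / 2) + F (\<theta> + pi) + F (\<theta> + 3 * pi / 2)))"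
    by (simp add: lattice_hom_onD[OF \<phi>] lattice_hom_on_0[OF \<phi>] F_ideal modulus_ideal principal_ideal_intros
        hom_F[OF \<phi>] hom_modulus[OF \<phi>] rot)
qed (intro principal_ideal_intros F_ideal modulus_ideal)+

end

text \<open>Exponent 1 suffices as witness. For every \<open>\<theta>\<close> the four-angle average
  of norms is at least \<open>1 + \<delta>\<close> by \<open>F_average_ge\<close>, and integration
  over the circle keeps the bound.\<close>

lemma upper_LUM_sum_imp_LUCC:
  assumes sum: "upper_LUM_sum TYPE('a::banach_lattice)"
  shows "complexification_LUCC TYPE('a)"
  unfolding complexification_LUCC_def complex_strongly_extreme_def
proof (intro allI impI, rule exI[of _ 1], intro conjI allI impI)
  fix z :: "'a \<times> 'a" and \<epsilon> :: real
  assume "cnorm z = 1" and \<epsilon>: "\<epsilon> > 0"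
  hence z: "norm (modulus z) = 1" by (simp add: cnorm_def)
  have "\<epsilon> / 2 > 0" using \<epsilon> by simp
  from four_rotations_gain[OF this] obtain c where c: "c > 0"
    "\<And>a b. norm a + c * max (norm b - \<epsilon> / 2 * norm a) 0 \<le>
      (norm (a + b) + norm (a + \<i> * b) + norm (a - b) + norm (a - \<i> * b)) / 4" by blast
  obtain \<delta> where \<delta>: "\<delta> > 0" "\<And>y. norm y \<ge> \<epsilon> \<Longrightarrow>
      1 + \<delta> \<le> norm (labs (modulus z) + c *\<^sub>R sup (labs y - (\<epsilon> / 2) *\<^sub>R labs (modulus z)) 0)"
    using upper_LUM_sum_excess[OF sum z \<epsilon> c(1)] by blast
  have "\<delta> \<le> (1 / (2 * pi) * integral {0..2 * pi} (\<lambda>\<theta>. cnorm (cadd z (crot \<theta> w)) powr 1)) powr (1 / 1) - 1"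
    if w: "cnorm w \<ge> \<epsilon>" for w
  proof -
    interpret complex_pair z w .
    have "2 * pi * (1 + \<delta>) \<le> integral {0..2 * pi} (\<lambda>\<theta>. norm (F \<theta>))"
    proof (rule integral_rotation_average[OF continuous_norm_F])
      fix \<theta>
      let ?l = "modulus z + c *\<^sub>R sup (modulus w - (\<epsilon> / 2) *\<^sub>R modulus z) 0"
      have "1 + \<delta> \<le> norm ?l" using \<delta>(2)[of "modulus w"] w by (simp add: cnorm_def labs_of_nonneg modulus_nonneg)
      also have "\<dots> \<le> norm ((1 / 4) *\<^sub>R (F \<theta> + F (\<theta> + pi / 2) + F (\<theta> + pi) + F (\<theta> + 3 * pi / 2)))"
        using c(1) by (intro norm_le_of_nonneg_le F_average_ge c(2) add_nonneg_nonneg scaleR_nonneg_nonneg modulus_nonneg) auto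
      also have "\<dots> \<le> (norm (F \<theta>) + norm (F (\<theta> + pi / 2)) + norm (F (\<theta> + pi)) + norm (F (\<theta> + 3 * pi / 2))) / 4"
        by (simp add: norm_triangle_le norm_triangle_ineq add_mono)
      finally show "1 + \<delta> \<le> (norm (F \<theta>) + norm (F (\<theta> + pi / 2)) + norm (F (\<theta> + pi)) + norm (F (\<theta> + 3 * pi / 2))) / 4" .
    qed
    hence "1 + \<delta> \<le> 1 / (2 * pi) * integral {0..2 * pi} (\<lambda>\<theta>. norm (F \<theta>))" by (simp add: field_simps)
    moreover from this have "0 \<le> 1 / (2 * pi) * integral {0..2 * pi} (\<lambda>\<theta>. norm (F \<theta>))"
      using \<delta>(1) by linarith
    ultimately show ?thesis unfolding cnorm_def powr_one[OF norm_ge_zero] div_by_1 by (simp only: powr_one)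
  qed
  thus "\<exists>\<delta>>0. \<forall>w. cnorm w \<ge> \<epsilon> \<longrightarrow>
      \<delta> \<le> (1 / (2 * pi) * integral {0..2 * pi} (\<lambda>\<theta>. cnorm (cadd z (crot \<theta> w)) powr 1)) powr (1 / 1) - 1"
    using \<delta>(1) by blast
qed simp

lemma modulus_real: "modulus (x, 0) = labs (x::'a::banach_lattice)"
proof (rule eq_by_lattice_hom)
  show u: "0 \<le> labs x" by simp
  have xI: "x \<in> principal_ideal (labs x)" "0 \<in> principal_ideal (labs x)"
    by (simp_all add: principal_ideal_le principal_ideal_0)
  show "modulus (x, 0) \<in> principal_ideal (labs x)" "labs x \<in> principal_ideal (labs x)"
    using lattice_hom_modulus(1)[OF u, of "(x, 0)"] xI by (simp_all add: principal_ideal_labs)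
  fix \<phi> assume \<phi>: "lattice_hom_on (principal_ideal (labs x)) \<phi>"
  show "\<phi> (modulus (x, 0)) = \<phi> (labs x)"
    using lattice_hom_modulus(2)[OF u _ _ \<phi>, of "(x, 0)"] xI
    by (simp add: lattice_hom_onD[OF \<phi>] lattice_hom_on_0[OF \<phi>] complex_norm)
qed

text \<open>Only real points \<open>(x, 0)\<close> and real directions \<open>(y, 0)\<close> are
  tested. There every rotated sum has modulus at most \<open>labs x + labs y\<close>, so the
  \<open>q\<close>-mean of the norms is bounded by the norm of this sum, whatever \<open>q\<close>
  is.\<close>

lemma LUCC_imp_upper_LUM_sum:
  assumes lucc: "complexification_LUCC TYPE('a::banach_lattice)"
  shows "upper_LUM_sum TYPE('a)"
  unfolding upper_LUM_sum_def
proof (intro allI impI)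
  fix x :: 'a and \<epsilon> :: real assume x: "norm x = 1" and \<epsilon>: "\<epsilon> > 0"
  have cn: "cnorm (y, 0) = norm y" for y :: 'a
    using modulus_real[of y] by (simp add: cnorm_def)
  have "complex_strongly_extreme (x, 0)" using lucc x cn unfolding complexification_LUCC_def by simp
  then obtain q :: real and \<delta> where q: "q > 0" and \<delta>: "\<delta> > 0" "\<And>w. cnorm w \<ge> \<epsilon> \<Longrightarrow>
      \<delta> \<le> (1 / (2 * pi) * integral {0..2 * pi} (\<lambda>\<theta>. cnorm (cadd (x, 0) (crot \<theta> w)) powr q)) powr (1 / q) - 1"
    using \<epsilon> unfolding complex_strongly_extreme_def by meson
  have "1 + \<delta> \<le> norm (labs x + labs y)" if y: "norm y \<ge> \<epsilon>" for y
  proof -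
    interpret complex_pair "(x, 0)" "(y, 0)" .
    define N where "N = norm (labs x + labs y)"
    have le: "norm (F \<theta>) \<le> N" for \<theta>
      using norm_le_of_nonneg_le[OF modulus_nonneg F_le[of \<theta>]] by (simp only: modulus_real N_def)
    have "(\<lambda>\<theta>. norm (F \<theta>) powr q) integrable_on {0..2 * pi}"
      using q by (intro integrable_continuous_interval continuous_on_powr' continuous_intros
          continuous_on_subset[OF continuous_norm_F]) auto
    hence int: "integral {0..2 * pi} (\<lambda>\<theta>. norm (F \<theta>) powr q) \<le> integral {0..2 * pi} (\<lambda>\<theta>. N powr q)"
      "0 \<le> integral {0..2 * pi} (\<lambda>\<theta>. norm (F \<theta>) powr q)"
      using le q by (intro integral_le integral_nonneg powr_mono2 integrable_const_ivl; simp)+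
    have "(1 / (2 * pi) * integral {0..2 * pi} (\<lambda>\<theta>. norm (F \<theta>) powr q)) powr (1 / q) \<le> (N powr q) powr (1 / q)"
      using int q by (intro powr_mono2) (auto simp: field_simps)
    also have "\<dots> = N" using q by (simp add: powr_powr N_def)
    finally show ?thesis using \<delta>(2)[of "(y, 0)"] y cn[of y] by (simp add: cnorm_def N_def)
  qed
  thus "\<exists>\<delta>>0. \<forall>y. norm y \<ge> \<epsilon> \<longrightarrow> 1 + \<delta> \<le> norm (labs x + labs y)" using \<delta>(1) by blast
qed

theorem theorem3p3:
  fixes M :: "'b measure" and \<Phi> :: "'a::banach_lattice \<Rightarrow> 'b \<Rightarrow> real"
  assumes "order_continuous TYPE('a) \<or> koethe_function_space M \<Phi>"
  shows "(upper_LUM TYPE('a) \<longleftrightarrow> complexification_LUCC TYPE('a))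
       \<and> (complexification_LUCC TYPE('a) \<longleftrightarrow> (\<forall>p>1. convexification_MLUC TYPE('a) p))
       \<and> ((\<forall>p>1. convexification_MLUC TYPE('a) p) \<longleftrightarrow> (\<exists>p>1. convexification_MLUC TYPE('a) p))"
proof -
  have "upper_LUM TYPE('a) \<longleftrightarrow> upper_LUM_sum TYPE('a)" by (rule upper_LUM_iff_sum)
  moreover have "complexification_LUCC TYPE('a) \<longleftrightarrow> upper_LUM_sum TYPE('a)"
    using upper_LUM_sum_imp_LUCC LUCC_imp_upper_LUM_sum by blast
  moreover have "(\<forall>p>1. convexification_MLUC TYPE('a) p) \<longleftrightarrow> upper_LUM_sum TYPE('a)"
    "(\<exists>p>1. convexification_MLUC TYPE('a) p) \<longleftrightarrow> upper_LUM_sum TYPE('a)"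
    \<comment> \<open>\<open>gt_ex\<close> supplies an exponent above 1 at which the universal
      condition is instantiated.\<close>
    using upper_LUM_sum_imp_MLUC MLUC_imp_upper_LUM_sum gt_ex[of "1::real"] by blast+
  ultimately show ?thesis by blast
qed

end
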